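(* Let $n$ be a positive integer and let $S$ be a sequence of $n$ integers in the interval $[0,n-1]$. If there is an integer $r$ such that every nonempty subsequence of $S$ whose sum is $\equiv 0 \pmod n$ has length equal to $r$, then $S$ has at most two distinct values.
   Context: A sequence here is a finite unordered sequence with repetition allowed (a finite multiset of integers). A subsequence is obtained by selecting some of the terms (a sub-multiset, i.e. the terms indexed by a subset of the index set; they need not be consecutive). The length of a sequence is its number of terms counted with multiplicity, and its sum is the sum of its terms counted with multiplicity. The interval $[0,n-1]$ denotes the set of integers $x$ with $0\le x\le n-1$. "$S$ has at most two distinct values" means that the set of integers occurring as terms of $S$ has at most two elements. *)

theory Defs
  imports "HOL-Library.Multiset" "HOL-Number_Theory.Cong"
begin

end

(*
  Let r be the common length of the zero-sum subsequences and h the maximal multiplicity, attained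
  by the term g.  Scherk's theorem gives r <= h.  If the order of g is at most h, work modulo the
  subgroup generated by g.  Otherwise, removing a zero-sum subsequence from S leaves a zero-sum free
  sequence of length n - r; this sequence, the copies of g, or (when n = 2r + 1 and h = r) the terms
  other than g form a zero-sum free sequence of length at least max(n/2, n - r).  By a form of the
  Savchev-Chen theorem, after multiplication by a unit its terms have positive integer
  representatives with sum less than n; in particular many of them are 1.  With respect to this
  generator, comparing zero sums that differ by exchanging a term y for y ones leaves room for only
  one further value.
*)

theory Submission
  imports Defs Complex_Main
begin

section \<open>Subsums and zero-sum free sequences\<close>

text \<open>Half the group order is the critical length for finding integer representatives. At that
  length some group element must fail to be a subsum; one further term \<open>i\<close> supplies
  such an element for the remaining terms, namely \<open>- a i\<close>. The bound
  \<open>r <= h\<close> secures a usable sequence: if \<open>h + r < n\<close> and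
  \<open>n - r\<close> is less than \<open>n / 2 + 1\<close>, then \<open>h = r\<close> and
  \<open>n = 2 * r + 1\<close>. In that borderline case either \<open>- nsmul h g\<close> is a
  missing subsum, or the sequence consists of the copies of \<open>g\<close> and one more term. The
  ones come from an average: \<open>v\<close> positive integers with sum \<open>s\<close> include at
  least \<open>2 * v - s\<close> ones, and \<open>s + 2 <= 2 * v\<close> makes every other term at
  most the number of ones. Such a term can therefore be exchanged for ones, which keeps the sum but
  changes the length. The condition \<open>n <= v + r\<close> leaves at most \<open>r\<close> terms
  outside the sequence; it is what forces equality in the extremal configuration.\<close>

primrec nsmul :: "nat \<Rightarrow> 'a::ab_group_add \<Rightarrow> 'a" where
  "nsmul 0 x = 0"
| "nsmul (Suc k) x = x + nsmul k x"

lemma nsmul_add: "nsmul (k + l) x = nsmul k x + nsmul l x"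
  by (induction k) (simp_all add: algebra_simps)

lemma nsmul_0_right [simp]: "nsmul k 0 = 0"
  by (induction k) simp_all

lemma nsmul_mult: "nsmul (k * l) x = nsmul k (nsmul l x)"
  by (induction k) (simp_all add: nsmul_add)

lemma nsmul_diff: "l \<le> k \<Longrightarrow> nsmul (k - l) x = nsmul k x - nsmul l x"
  by (metis add_diff_cancel_right' le_add_diff_inverse2 nsmul_add)

lemma sum_const_nsmul: "finite A \<Longrightarrow> (\<And>i. i \<in> A \<Longrightarrow> f i = x) \<Longrightarrow> sum f A = nsmul (card A) x"
  by (induction A rule: finite_induct) simp_all

lemma sum_nsmul: "finite A \<Longrightarrow> (\<And>i. i \<in> A \<Longrightarrow> f i = nsmul (b i) x) \<Longrightarrow> sum f A = nsmul (sum b A) x"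
  by (induction A rule: finite_induct) (simp_all add: nsmul_add)

definition subsums :: "('i \<Rightarrow> 'a::comm_monoid_add) \<Rightarrow> 'i set \<Rightarrow> 'a set" where
  "subsums a V = sum a ` Pow V"

definition zero_sum_free :: "('i \<Rightarrow> 'a::comm_monoid_add) \<Rightarrow> 'i set \<Rightarrow> bool" where
  "zero_sum_free a V \<longleftrightarrow> (\<forall>A\<subseteq>V. A \<noteq> {} \<longrightarrow> sum a A \<noteq> 0)"

lemma zero_sum_freeD: "zero_sum_free a V \<Longrightarrow> A \<subseteq> V \<Longrightarrow> A \<noteq> {} \<Longrightarrow> sum a A \<noteq> 0"
  by (simp add: zero_sum_free_def)

lemma zero_sum_free_subset: "zero_sum_free a V \<Longrightarrow> W \<subseteq> V \<Longrightarrow> zero_sum_free a W"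
  by (auto simp: zero_sum_free_def)

lemma zero_sum_free_nonzero: "zero_sum_free a V \<Longrightarrow> i \<in> V \<Longrightarrow> a i \<noteq> 0"
  using zero_sum_freeD[of a V "{i}"] by simp

lemma subsumsI: "A \<subseteq> V \<Longrightarrow> sum a A \<in> subsums a V"
  by (simp add: subsums_def)

lemma subsumsE:
  assumes "p \<in> subsums a V"
  obtains A where "A \<subseteq> V" "p = sum a A"
  using assms by (auto simp: subsums_def)

lemma finite_subsums [simp]: "finite V \<Longrightarrow> finite (subsums a V)"
  by (simp add: subsums_def)

lemma zero_in_subsums [simp]: "0 \<in> subsums a V"
  using subsumsI[of "{}"] by simp

lemma subsums_mono: "V \<subseteq> W \<Longrightarrow> subsums a V \<subseteq> subsums a W"
  by (auto simp: subsums_def)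

lemma subsums_insert:
  assumes "finite V" "i \<notin> V"
  shows "subsums a (insert i V) = subsums a V \<union> (+) (a i) ` subsums a V"
proof -
  have "sum a ` insert i ` Pow V = (\<lambda>A. a i + sum a A) ` Pow V"
    unfolding image_image
    by (rule image_cong) (use assms in \<open>auto simp: sum.insert_if finite_subset\<close>)
  then show ?thesis
    by (simp add: subsums_def Pow_insert image_Un image_image)
qed

lemma subsums_compl:
  fixes a :: "'i \<Rightarrow> 'a::ab_group_add"
  assumes "finite V" "p \<in> subsums a V"
  shows "sum a V - p \<in> subsums a V"
proof -
  obtain A where A: "A \<subseteq> V" "p = sum a A"
    using assms(2) by (rule subsumsE)
  have "sum a V - p = sum a (V - A)"
    using A assms(1) by (simp add: sum_diff)
  then show ?thesis
    using subsumsI[of "V - A" V a] by auto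
qed

lemma uminus_notin_subsums:
  fixes a :: "'i \<Rightarrow> 'a::ab_group_add"
  assumes "finite V" "i \<notin> V" "zero_sum_free a (insert i V)"
  shows "- a i \<notin> subsums a V"
proof
  assume "- a i \<in> subsums a V"
  then obtain A where A: "A \<subseteq> V" "- a i = sum a A"
    by (rule subsumsE)
  then have "sum a (insert i A) = 0"
    using assms by (metis add.right_inverse finite_subset subsetD sum.insert)
  then show False
    using zero_sum_freeD[OF assms(3), of "insert i A"] A by blast
qed

text \<open>A translation mapping a finite set into itself is onto, so it would reach
  \<open>0\<close>, and only \<open>- x\<close> can be sent there.\<close>

lemma translate_escape:
  fixes x :: "'a::ab_group_add"
  assumes "finite P" "0 \<in> P" "- x \<notin> P"
  shows "\<exists>p\<in>P. x + p \<notin> P"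
proof (rule ccontr)
  assume "\<not> ?thesis"
  then have "(+) x ` P \<subseteq> P" by auto
  then have "(+) x ` P = P"
    using assms(1) by (simp add: card_image card_subset_eq)
  then obtain p where "p \<in> P" "x + p = 0"
    using assms(2) by (metis (no_types, lifting) imageE)
  then show False
    using assms(3) by (metis add_eq_0_iff)
qed

text \<open>Each further term \<open>i\<close> creates a new subsum: \<open>- a i\<close> is not a
  subsum of the terms before it, so \<open>translate_escape\<close> applies.\<close>

lemma card_subsums_mono:
  fixes a :: "'i \<Rightarrow> 'a::ab_group_add"
  assumes "finite V" "W \<subseteq> V" "zero_sum_free a V"
  shows "card (subsums a W) + card (V - W) \<le> card (subsums a V)"
proof -
  have "finite (V - W)" using assms(1) by simp
  moreover have "U \<subseteq> V - W \<Longrightarrow> card (subsums a W) + card U \<le> card (subsums a (W \<union> U))"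
    if "finite U" for U using that
  proof (induction U rule: finite_induct)
    case (insert i U)
    let ?P = "subsums a (W \<union> U)"
    have fin: "finite (W \<union> U)" "i \<notin> W \<union> U" "finite W"
      using insert assms by (auto intro: finite_subset)
    have "zero_sum_free a (insert i (W \<union> U))"
      by (rule zero_sum_free_subset[OF assms(3)]) (use insert assms in auto)
    then obtain p where p: "p \<in> ?P" "a i + p \<notin> ?P"
      using translate_escape[of ?P "a i"] uminus_notin_subsums[of "W \<union> U" i a] fin by auto
    have "insert (a i + p) ?P \<subseteq> subsums a (W \<union> insert i U)"
      using subsums_insert[OF fin(1,2), of a] p by auto
    then have "card (insert (a i + p) ?P) \<le> card (subsums a (W \<union> insert i U))"
      using fin insert by (intro card_mono) auto
    then show ?case using insert p fin by simp
  qed simp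
  ultimately show ?thesis
    using assms(2) by (metis Un_Diff_cancel order_refl sup.absorb2)
qed

lemma card_less_subsums:
  fixes a :: "'i \<Rightarrow> 'a::ab_group_add"
  assumes "finite V" "zero_sum_free a V"
  shows "card V < card (subsums a V)"
  using card_subsums_mono[of V "{}" a] assms by (simp add: subsums_def)

text \<open>Scherk's theorem, by the e-transform: move the elements \<open>y\<close> of \<open>B\<close> with \<open>e + y \<notin> A\<close> over to \<open>A\<close>.\<close>

lemma card_sumset_ge:
  fixes A B :: "'a::ab_group_add set"
  assumes "finite A" "finite B" "0 \<in> A" "0 \<in> B"
    and "\<And>x y. x \<in> A \<Longrightarrow> y \<in> B \<Longrightarrow> x + y = 0 \<Longrightarrow> y = 0"
  shows "card A + card B \<le> card ((\<lambda>(x, y). x + y) ` (A \<times> B)) + 1"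
  using assms
proof (induction "card B" arbitrary: A B rule: less_induct)
  case less
  show ?case
  proof (cases "B = {0}")
    case True
    then have "(\<lambda>(x, y). x + y) ` (A \<times> B) = A" by (auto simp: image_iff)
    then show ?thesis using True by simp
  next
    case False
    then obtain b where b: "b \<in> B" "b \<noteq> 0" using less.prems by blast
    have "- b \<notin> A" using less.prems(5)[of "- b" b] b by auto
    then obtain e where e: "e \<in> A" "b + e \<notin> A"
      using translate_escape[of A b] less.prems by auto
    define D where "D = {y \<in> B. e + y \<notin> A}"
    define A' where "A' = A \<union> (+) e ` D"
    define B' where "B' = B - D"
    have D: "D \<subseteq> B" "b \<in> D" "0 \<notin> D" "finite D"
      using b e less.prems by (auto simp: D_def add.commute)
    have "B = B' \<union> D" "B' \<inter> D = {}" using D by (auto simp: B'_def)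
    then have "card B = card B' + card D"
      using D less.prems by (metis card_Un_disjoint finite_Un)
    moreover have "card D > 0" using D card_gt_0_iff by blast
    ultimately have cardB': "card B' + card D = card B" "card B' < card B" by simp_all
    have cardA': "card A' = card A + card D"
      unfolding A'_def using D less.prems
      by (subst card_Un_disjoint) (auto simp: D_def card_image)
    \<comment> \<open>For \<open>x = e + d\<close> with \<open>d\<close> in \<open>D\<close>,
      regroup as \<open>(e + y) + d\<close>; \<open>y\<close> was kept in \<open>B'\<close>
      precisely because \<open>e + y\<close> lies in \<open>A\<close>.\<close>
    have sub: "x + y \<in> (\<lambda>(x, y). x + y) ` (A \<times> B)" if xy: "x \<in> A'" "y \<in> B'" for x y
    proof (cases "x \<in> A")
      case True
      then show ?thesis using that by (auto simp: B'_def)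
    next
      case False
      then obtain d where d: "d \<in> D" "x = e + d" using xy by (auto simp: A'_def)
      have "x + y = (e + y) + d" using d by (simp add: algebra_simps)
      moreover have "e + y \<in> A" using that by (auto simp: B'_def D_def)
      ultimately show ?thesis using d D by (intro image_eqI[of _ _ "(e + y, d)"]) auto
    qed
    have "y = 0" if xy: "x \<in> A'" "y \<in> B'" "x + y = 0" for x y
    proof (cases "x \<in> A")
      case True
      then show ?thesis using that less.prems(5) by (auto simp: B'_def)
    next
      case False
      then obtain d where d: "d \<in> D" "x = e + d" using xy by (auto simp: A'_def)
      have "(e + y) + d = 0" using d that by (simp add: algebra_simps)
      moreover have "e + y \<in> A" using that by (auto simp: B'_def D_def)
      ultimately have "d = 0" using less.prems(5) d D by blast
      then show ?thesis using d D by blast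
    qed
    then have "card A' + card B' \<le> card ((\<lambda>(x, y). x + y) ` (A' \<times> B')) + 1"
      using cardB' D less.prems by (intro less.hyps) (auto simp: A'_def B'_def)
    also have "card ((\<lambda>(x, y). x + y) ` (A' \<times> B')) \<le> card ((\<lambda>(x, y). x + y) ` (A \<times> B))"
      using less.prems sub by (intro card_mono) auto
    finally show ?thesis using cardA' cardB' by simp
  qed
qed

section \<open>Finite subgroups of an abelian group, and short zero sums in them\<close>

locale finite_add_subgroup =
  fixes G :: "'a::ab_group_add set"
  assumes finite_G [simp]: "finite G"
    and zero_closed [simp]: "0 \<in> G"
    and add_closed: "x \<in> G \<Longrightarrow> y \<in> G \<Longrightarrow> x + y \<in> G"
    and uminus_closed: "x \<in> G \<Longrightarrow> - x \<in> G"
begin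

lemma sum_closed: "(\<And>i. i \<in> A \<Longrightarrow> a i \<in> G) \<Longrightarrow> sum a A \<in> G"
  by (induction A rule: infinite_finite_induct) (auto simp: add_closed)

lemma nsmul_closed: "x \<in> G \<Longrightarrow> nsmul k x \<in> G"
  by (induction k) (auto simp: add_closed)

lemma subsums_closed: "a ` V \<subseteq> G \<Longrightarrow> subsums a V \<subseteq> G"
  by (auto simp: subsums_def intro!: sum_closed)

lemma card_G_pos: "card G > 0"
  using zero_closed finite_G card_gt_0_iff by blast

text \<open>Give equal terms different colours, using \<open>h\<close> colours. Adding up the sets
  \<open>{0} \<union> (terms of one colour)\<close>, the sumset grows by at least the size of each
  class by \<open>card_sumset_ge\<close> and would outgrow \<open>G\<close>, unless some zero sum
  uses each colour at most once.\<close>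

lemma short_zero_sum:
  assumes "finite I" "a ` I \<subseteq> G" "card G \<le> card I"
    and mult: "\<And>v. card {i \<in> I. a i = v} \<le> h"
  obtains J where "J \<subseteq> I" "J \<noteq> {}" "card J \<le> h" "sum a J = 0"
proof -
  have "\<exists>f. inj_on f {i \<in> I. a i = v} \<and> f ` {i \<in> I. a i = v} \<subseteq> {..<h}" for v
    using card_le_inj[of "{i \<in> I. a i = v}" "{..<h}"] mult[of v] assms(1) by auto
  then obtain f where f: "\<And>v. inj_on (f v) {i \<in> I. a i = v}"
      "\<And>v. f v ` {i \<in> I. a i = v} \<subseteq> {..<h}"
    by metis
  \<comment> \<open>a partition of the terms into \<open>h\<close> classes, each consisting of distinct elements\<close>
  define col where "col i = f (a i) i" for i
  have col_less: "col i < h" if "i \<in> I" for i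
    using f(2)[of "a i"] that by (auto simp: col_def)
  have inj: "inj_on a {i \<in> I. col i = k}" for k
  proof (rule inj_onI)
    fix i j assume ij: "i \<in> {i \<in> I. col i = k}" "j \<in> {i \<in> I. col i = k}" "a i = a j"
    then have "f (a i) i = f (a i) j" by (auto simp: col_def)
    then show "i = j"
      using inj_onD[OF f(1)[of "a i"], of i j] ij by auto
  qed
  show thesis
  proof (rule ccontr)
    assume "\<not> thesis"
    then have no: "sum a J \<noteq> 0" if "J \<subseteq> I" "J \<noteq> {}" "card J \<le> h" for J
      using that \<open>\<And>J. J \<subseteq> I \<Longrightarrow> J \<noteq> {} \<Longrightarrow> card J \<le> h \<Longrightarrow> sum a J = 0 \<Longrightarrow> thesis\<close> by blast
    \<comment> \<open>Sums of subsets using each of the first \<open>k\<close> colours at most once.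
      For \<open>k \<le> h\<close> such a subset has at most \<open>h\<close> terms, so
      \<open>no\<close> provides the hypothesis of \<open>card_sumset_ge\<close>.\<close>
    define B where "B k = sum a ` {J. J \<subseteq> I \<and> col ` J \<subseteq> {..<k} \<and> inj_on col J}" for k
    have finB: "finite (B k)" for k
      unfolding B_def using assms(1) by (intro finite_imageI) 
        (auto intro: finite_subset[OF _ finite_Pow_iff[THEN iffD2, OF assms(1)]])
    have "k \<le> h \<Longrightarrow> card {i \<in> I. col i < k} < card (B k)" for k
    proof (induction k)
      case 0
      have "B 0 = {0}" by (auto simp: B_def)
      then show ?case by simp
    next
      case (Suc k)
      let ?C = "{i \<in> I. col i = k}"
      define A where "A = insert 0 (a ` ?C)"
      have "0 \<notin> a ` ?C"
      proof
        assume "0 \<in> a ` ?C"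
        then obtain i where "i \<in> I" "a i = 0" by auto
        then show False using no[of "{i}"] Suc.prems by simp
      qed
      then have cardA: "card A = Suc (card ?C)"
        using assms(1) inj by (simp add: A_def card_image)
      have step: "J \<union> {i} \<subseteq> I \<and> col ` (J \<union> {i}) \<subseteq> {..<Suc k} \<and> inj_on col (J \<union> {i})
          \<and> sum a (J \<union> {i}) = sum a J + a i"
        if "J \<subseteq> I" "col ` J \<subseteq> {..<k}" "inj_on col J" "i \<in> I" "col i = k" for J i
      proof -
        have "i \<notin> J" "col i \<notin> col ` J" "finite J"
          using that assms(1) by (auto intro: finite_subset)
        then show ?thesis using that by (auto simp: add.commute)
      qed
      have sub: "x + y \<in> B (Suc k)" if xy: "x \<in> B k" "y \<in> A" for x y
      proof -
        obtain J where J: "J \<subseteq> I" "col ` J \<subseteq> {..<k}" "inj_on col J" "x = sum a J"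
          using xy(1) unfolding B_def by blast
        show ?thesis
        proof (cases "y = 0")
          case True
          have "col ` J \<subseteq> {..<Suc k}" using J(2) by fastforce
          then show ?thesis
            unfolding B_def using J True by (intro image_eqI[of _ _ J]) auto
        next
          case False
          then obtain i where i: "i \<in> I" "col i = k" "y = a i" using xy(2) by (auto simp: A_def)
          show ?thesis
            unfolding B_def using step[OF J(1-3) i(1,2)] J(4) i(3)
            by (intro image_eqI[of _ _ "J \<union> {i}"]) auto
        qed
      qed
      have trivial: "y = 0" if xy: "x \<in> B k" "y \<in> A" "x + y = 0" for x y
      proof (rule ccontr)
        assume "y \<noteq> 0"
        obtain J where J: "J \<subseteq> I" "col ` J \<subseteq> {..<k}" "inj_on col J" "x = sum a J"
          using xy unfolding B_def by blast
        obtain i where i: "i \<in> I" "col i = k" "y = a i" using xy(2) \<open>y \<noteq> 0\<close> by (auto simp: A_def)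
        have st: "J \<union> {i} \<subseteq> I" "col ` (J \<union> {i}) \<subseteq> {..<Suc k}" "inj_on col (J \<union> {i})"
          "sum a (J \<union> {i}) = 0" using step[OF J(1-3) i(1,2)] J i xy by auto
        have "card (J \<union> {i}) = card (col ` (J \<union> {i}))" using st(3) by (rule card_image[symmetric])
        also have "\<dots> \<le> card {..<Suc k}" using st(2) by (intro card_mono) auto
        finally show False using no[OF st(1)] st(4) Suc.prems by auto
      qed
      have "0 \<in> B k" unfolding B_def by (rule image_eqI[of _ _ "{}"]) auto
      moreover have "finite A" "0 \<in> A" using assms(1) by (simp_all add: A_def)
      ultimately have "card (B k) + card A \<le> card ((\<lambda>(x, y). x + y) ` (B k \<times> A)) + 1"
        using trivial by (intro card_sumset_ge[OF finB])
      also have "card ((\<lambda>(x, y). x + y) ` (B k \<times> A)) \<le> card (B (Suc k))"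
        by (rule card_mono[OF finB]) (use sub in auto)
      finally have "card {i \<in> I. col i < k} + card ?C < card (B (Suc k))"
        using Suc cardA by simp
      moreover have "{i \<in> I. col i < Suc k} = {i \<in> I. col i < k} \<union> ?C" by auto
      moreover have "card ({i \<in> I. col i < k} \<union> ?C) = card {i \<in> I. col i < k} + card ?C"
        using assms(1) by (intro card_Un_disjoint) auto
      ultimately show ?case by simp
    qed
    from this[of h] have "card I < card (B h)"
      using col_less by (simp cong: conj_cong)
    moreover have "card (B h) \<le> card G"
      using assms(2) by (intro card_mono) (auto simp: B_def intro!: sum_closed)
    ultimately show False using assms(3) by simp
  qed
qed

end

section \<open>The complement of the subsums of a long zero-sum free sequence\<close>

context finite_add_subgroup
begin

lemma order_exists:
  assumes "x \<in> G"
  obtains m where "m > 0" "nsmul m x = 0" "inj_on (\<lambda>i. nsmul i x) {..<m}"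
    "\<And>i. 0 < i \<Longrightarrow> i < m \<Longrightarrow> nsmul i x \<noteq> 0"
proof -
  have "\<not> inj_on (\<lambda>i. nsmul i x) {..card G}"
  proof
    assume "inj_on (\<lambda>i. nsmul i x) {..card G}"
    then have "card {..card G} \<le> card G"
      by (rule card_inj_on_le) (auto simp: nsmul_closed assms)
    then show False by simp
  qed
  then obtain i j where "i < j" "nsmul i x = nsmul j x"
    unfolding inj_on_def by (metis nat_neq_iff)
  then have "j - i > 0 \<and> nsmul (j - i) x = 0"
    by (simp add: nsmul_diff)
  then obtain m where m: "m > 0 \<and> nsmul m x = 0" "\<And>i. i < m \<Longrightarrow> \<not> (i > 0 \<and> nsmul i x = 0)"
    using exists_least_iff[of "\<lambda>m. m > 0 \<and> nsmul m x = 0"] by blast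
  have "inj_on (\<lambda>i. nsmul i x) {..<m}"
  proof (rule linorder_inj_onI)
    fix i j assume ij: "i < j" "i \<in> {..<m}" "j \<in> {..<m}"
    show "nsmul i x \<noteq> nsmul j x"
    proof
      assume "nsmul i x = nsmul j x"
      then have "nsmul (j - i) x = 0" using ij by (simp add: nsmul_diff)
      then show False using m(2)[of "j - i"] ij less_imp_diff_less[of j m i] by auto
    qed
  qed auto
  then show thesis using that m by blast
qed

lemma nsmul_minus:
  assumes "nsmul m x = 0" "i \<le> m"
  shows "nsmul (m - i) x = - nsmul i x"
  using assms by (simp add: nsmul_diff)

lemma nsmul_mod:
  assumes "nsmul m x = 0"
  shows "nsmul (i mod m) x = nsmul i x"
proof -
  have "nsmul i x = nsmul (i div m) (nsmul m x) + nsmul (i mod m) x"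
    by (metis div_mult_mod_eq nsmul_add nsmul_mult)
  then show ?thesis using assms by simp
qed

text \<open>The order of \<open>x\<close> exceeds \<open>s\<close>, hence half of
  \<open>card G\<close>, so a second coset of its multiples does not fit into
  \<open>G\<close>.\<close>

lemma generator:
  assumes "x \<in> G" and nz: "\<And>i. 0 < i \<Longrightarrow> i \<le> s \<Longrightarrow> nsmul i x \<noteq> 0" and "card G < 2 * (s + 1)"
  shows "s < card G" "nsmul i x = 0 \<longleftrightarrow> card G dvd i" "g \<in> G \<Longrightarrow> \<exists>i<card G. g = nsmul i x"
proof -
  obtain m where m: "m > 0" "nsmul m x = 0" "inj_on (\<lambda>i. nsmul i x) {..<m}"
    "\<And>i. 0 < i \<Longrightarrow> i < m \<Longrightarrow> nsmul i x \<noteq> 0"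
    using order_exists[OF assms(1)] by blast
  have "s < m" using nz[of m] m by (meson leI)
  define H where "H = (\<lambda>i. nsmul i x) ` {..<m}"
  have H: "H \<subseteq> G" "card H = m" "finite H"
    using m by (auto simp: H_def card_image nsmul_closed assms)
  have nsH: "nsmul i x \<in> H" for i
    unfolding H_def using nsmul_mod[OF m(2), of i] m(1) by (metis imageI lessThan_iff mod_less_divisor)
  have "H = G"
  proof (rule ccontr)
    assume "H \<noteq> G"
    then obtain y where y: "y \<in> G" "y \<notin> H" using H by auto
    have "H \<inter> (+) y ` H = {}"
    proof (rule ccontr)
      assume "H \<inter> (+) y ` H \<noteq> {}"
      then obtain i j where "nsmul i x = y + nsmul j x" "j < m" by (auto simp: H_def)
      then have "y = nsmul i x + nsmul (m - j) x"
        using nsmul_minus[OF m(2), of j] by (simp add: algebra_simps)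
      then show False using y nsH by (metis nsmul_add)
    qed
    then have "card (H \<union> (+) y ` H) = 2 * m"
      using H by (simp add: card_Un_disjoint card_image)
    moreover have "H \<union> (+) y ` H \<subseteq> G" using H y add_closed by auto
    ultimately have "2 * m \<le> card G" using card_mono[OF finite_G] by metis
    then show False using assms(3) \<open>s < m\<close> by simp
  qed
  then have c: "card G = m" using H by simp
  show "s < card G" using c \<open>s < m\<close> by simp
  show "nsmul i x = 0 \<longleftrightarrow> card G dvd i"
  proof
    assume "nsmul i x = 0"
    then have "nsmul (i mod m) x = 0" using nsmul_mod[OF m(2)] by simp
    then have "i mod m = 0" using m(4)[of "i mod m"] m(1) by (meson gr0I mod_less_divisor)
    then show "card G dvd i" using c by auto
  next
    assume "card G dvd i"
    then have "i mod m = 0" using c by auto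
    then show "nsmul i x = 0" using nsmul_mod[OF m(2), of i] by simp
  qed
  show "\<exists>i<card G. g = nsmul i x" if "g \<in> G"
    using that \<open>H = G\<close> c unfolding H_def by auto
qed

text \<open>Extend \<open>W0\<close> to a maximal \<open>W\<close> with at least \<open>2 * card W\<close> subsums.  Translation by a term outside
  \<open>W\<close> then leaves the set of subsums of \<open>W\<close> only at the total sum and enters it only at \<open>0\<close>.  Two
  distinct terms \<open>x\<close>, \<open>y\<close> outside \<open>W\<close> would make \<open>y\<close>, \<open>y - x\<close> and finally \<open>- x\<close> subsums of \<open>W\<close>,
  which is impossible; so all terms outside \<open>W\<close> are equal, and a count of cosets of the subgroup
  generated by that term determines the elements that are not subsums of \<open>V\<close>.\<close>

lemma long_zero_sum_free_complement:
  assumes fin: "finite V" and aV: "a ` V \<subseteq> G" and zsf: "zero_sum_free a V"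
    and long: "card G \<le> 2 * card V" and small: "card (subsums a V) < 2 * card V"
    and W0: "W0 \<subseteq> V" "W0 \<noteq> {}" "2 * card W0 \<le> card (subsums a W0)"
  shows "\<exists>i\<in>V - W0. (subsums a V \<noteq> G \<longrightarrow> - a i \<notin> subsums a V) \<and>
    (\<forall>g\<in>G - subsums a V. \<exists>c. 1 \<le> c \<and> c \<le> card {j \<in> V - W0. a j = a i} \<and> g = - nsmul c (a i))"
proof -
  let ?Q = "\<lambda>W. W0 \<subseteq> W \<and> W \<subseteq> V \<and> 2 * card W \<le> card (subsums a W)"
  have "\<exists>W. ?Q W \<and> (\<forall>W'. ?Q W' \<longrightarrow> card W' \<le> card W)"
    using W0 card_mono[OF fin] by (intro ex_has_greatest_nat[where b = "Suc (card V)"]) (auto simp: le_imp_less_Suc)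
  then obtain W where W: "W0 \<subseteq> W" "W \<subseteq> V" "2 * card W \<le> card (subsums a W)"
    and max: "\<And>W'. ?Q W' \<Longrightarrow> card W' \<le> card W" by blast
  have finW: "finite W" using W fin finite_subset by blast
  define P where "P = subsums a W"
  define \<sigma> where "\<sigma> = sum a W"
  have finP: "finite P" and zP: "0 \<in> P" and sP: "\<sigma> \<in> P"
    using finW by (simp_all add: P_def \<sigma>_def subsumsI)
  have symP: "\<sigma> - p \<in> P" if "p \<in> P" for p
    using that subsums_compl[OF finW] by (auto simp: P_def \<sigma>_def)
  have "\<sigma> \<noteq> 0"
    using zero_sum_freeD[OF zsf, of W] W W0 by (auto simp: \<sigma>_def)
  \<comment> \<open>Maximality of \<open>W\<close> allows at most \<open>2 * card W + 1\<close>
    subsums after adding \<open>j\<close>, while zero-sum freeness forces at least one new subsum;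
    so equality holds throughout.\<close>
  have grow: "card P = 2 * card W \<and> card (subsums a (insert j W)) = card P + 1" if "j \<in> V - W" for j
  proof -
    have "\<not> ?Q (insert j W)"
      using max[of "insert j W"] that finW by auto
    then have "card (subsums a (insert j W)) < 2 * (card W + 1)"
      using that W finW by auto
    moreover have "card P + 1 \<le> card (subsums a (insert j W))"
      using card_subsums_mono[of "insert j W" W a] zero_sum_free_subset[OF zsf, of "insert j W"] that W finW
      by (auto simp: P_def insert_Diff_if)
    ultimately show ?thesis using W by (auto simp: P_def)
  qed
  have notin: "- a j \<notin> P" if "j \<in> V - W" for j
    unfolding P_def using that W finW zero_sum_free_subset[OF zsf, of "insert j W"]
    by (intro uminus_notin_subsums) auto
  have escape: "{p \<in> P. a j + p \<notin> P} = {\<sigma>}" if j: "j \<in> V - W" for j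
  proof -
    define E where "E = {p \<in> P. a j + p \<notin> P}"
    have "subsums a (insert j W) = P \<union> (+) (a j) ` E"
      using subsums_insert[OF finW, of j a] j by (auto simp: P_def E_def)
    moreover have "P \<inter> (+) (a j) ` E = {}" by (auto simp: E_def)
    moreover have "finite E" using finP by (simp add: E_def)
    ultimately have "card (subsums a (insert j W)) = card P + card E"
      using finP by (simp add: card_Un_disjoint card_image)
    then have "card E = 1" using grow[OF j] by simp
    \<comment> \<open>The reflection \<open>p \<mapsto> \<sigma> - p\<close> of \<open>P\<close>
      would carry \<open>a j + \<sigma>\<close> to the forbidden \<open>- a j\<close>.\<close>
    moreover have "\<sigma> \<in> E"
    proof -
      have "a j + \<sigma> \<notin> P"
        using symP[of "a j + \<sigma>"] notin[OF j] by auto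
      then show ?thesis using sP by (simp add: E_def)
    qed
    ultimately show ?thesis unfolding E_def by (metis card_1_singletonE singletonD)
  qed
  have up: "a j + p \<in> P" if "j \<in> V - W" "p \<in> P" "p \<noteq> \<sigma>" for j p
    using escape[OF that(1)] that by blast
  have down: "p - a j \<in> P" if "j \<in> V - W" "p \<in> P" "p \<noteq> 0" for j p
  proof -
    have "\<sigma> - p \<noteq> \<sigma>" using that by simp
    then have "a j + (\<sigma> - p) \<in> P" using up[OF that(1) symP[OF that(2)]] by simp
    then have "\<sigma> - (a j + (\<sigma> - p)) \<in> P" by (rule symP)
    then show ?thesis by (simp add: algebra_simps)
  qed
  have const: "a j = a i" if ij: "i \<in> V - W" "j \<in> V - W" for i j
  proof (rule ccontr)
    assume "a j \<noteq> a i"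
    have "a j \<in> P" using up[OF ij(2) zP] \<open>\<sigma> \<noteq> 0\<close> by simp
    moreover have "a j \<noteq> 0" using zero_sum_free_nonzero[OF zsf] ij by blast
    ultimately have "a j - a i \<in> P" by (rule down[OF ij(1)])
    then have "(a j - a i) - a j \<in> P" using \<open>a j \<noteq> a i\<close> by (intro down[OF ij(2)]) auto
    then show False using notin[OF ij(1)] by simp
  qed
  have "W \<noteq> V" using W small by auto
  then obtain i where i: "i \<in> V - W" using W by blast
  define x where "x = a i"
  define t where "t = card (V - W)"
  have "x \<in> G" using i aV by (auto simp: x_def)
  have "P \<subseteq> G" unfolding P_def using aV W by (intro subsums_closed) auto
  obtain m where m: "m > 0" "nsmul m x = 0" "inj_on (\<lambda>i. nsmul i x) {..<m}"
    "\<And>i. 0 < i \<Longrightarrow> i < m \<Longrightarrow> nsmul i x \<noteq> 0"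
    using order_exists[OF \<open>x \<in> G\<close>] by blast
  define H where "H = (\<lambda>i. nsmul i x) ` {..<m}"
  have H: "H \<subseteq> G" "card H = m" "finite H"
    using m by (auto simp: H_def card_image nsmul_closed \<open>x \<in> G\<close>)
  have nsH: "nsmul i x \<in> H" for i
    unfolding H_def using nsmul_mod[OF m(2), of i] m(1) by (metis imageI lessThan_iff mod_less_divisor)
  have minusH: "- nsmul i x \<in> H" for i
  proof -
    have "- nsmul i x = nsmul (m - i mod m) x"
      using nsmul_minus[OF m(2), of "i mod m"] nsmul_mod[OF m(2), of i] m(1) by (simp add: less_imp_le)
    then show ?thesis using nsH by simp
  qed
  have last: "nsmul (m - 1) x = - x" using nsmul_minus[OF m(2), of 1] m(1) by simp
  have "\<exists>k. nsmul (Suc k) x \<notin> P"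
  proof (cases "m - 1")
    case 0
    then have "- x = 0" using last by simp
    then show ?thesis using notin[OF i] zP by (simp add: x_def)
  next
    case (Suc k)
    then show ?thesis using last notin[OF i] by (intro exI[of _ k]) (simp add: x_def)
  qed
  \<comment> \<open>The multiples \<open>0, x, ..., k x\<close> form an initial arc inside
    \<open>P\<close>. Translation by \<open>x\<close> leaves \<open>P\<close> only at
    \<open>\<sigma>\<close>, so the arc ends there; it turns out to be all of
    \<open>P \<inter> H\<close>.\<close>
  then obtain k where k: "nsmul (Suc k) x \<notin> P" "\<And>l. l < k \<Longrightarrow> nsmul (Suc l) x \<in> P"
    using exists_least_iff[of "\<lambda>k. nsmul (Suc k) x \<notin> P"] by blast
  have arc: "nsmul l x \<in> P" if "l \<le> k" for l
    using that k(2)[of "l - 1"] zP by (cases l) auto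
  have \<sigma>k: "\<sigma> = nsmul k x"
    using up[OF i arc[of k]] k(1) by (auto simp: x_def)
  have arc_only: "l \<le> k" if "l < m" "nsmul l x \<in> P" for l
  proof (rule ccontr)
    assume "\<not> l \<le> k"
    have "nsmul (l + d) x \<in> P" if "l + d < m" for d using that
    proof (induction d)
      case (Suc d)
      have "nsmul (l + d) x \<noteq> \<sigma>"
        using inj_onD[OF m(3), of "l + d" k] Suc.prems \<open>\<not> l \<le> k\<close> by (auto simp: \<sigma>k)
      then show ?case using up[OF i, of "nsmul (l + d) x"] Suc by (simp add: x_def)
    qed (use \<open>nsmul l x \<in> P\<close> in simp)
    from this[of "m - 1 - l"] show False using \<open>l < m\<close> last notin[OF i] by (simp add: x_def)
  qed
  have "\<not> m - 1 \<le> k"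
    using last notin[OF i] arc[of "m - 1"] by (auto simp: x_def)
  then have "k < m" by simp
  \<comment> \<open>As \<open>\<sigma>\<close> lies in \<open>H\<close>, translation by
    \<open>x\<close> never leaves \<open>F\<close>, which is therefore a union of full cosets of
    \<open>H\<close>.\<close>
  define F where "F = P - H"
  have finF: "finite F" using finP by (simp add: F_def)
  have FH: "card (F \<union> H) = card F + m"
    using finF H by (subst card_Un_disjoint) (auto simp: F_def)
  have F_up: "p + nsmul l x \<in> F" if "p \<in> F" for p l
  proof (induction l)
    case (Suc l)
    then have "p + nsmul l x \<noteq> \<sigma>" using nsH by (auto simp: F_def \<sigma>k)
    then have "x + (p + nsmul l x) \<in> P" using Suc up[OF i] by (auto simp: F_def x_def)
    moreover have "x + (p + nsmul l x) \<notin> H"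
    proof
      assume "x + (p + nsmul l x) \<in> H"
      then obtain c where "x + (p + nsmul l x) = nsmul c x" by (auto simp: H_def)
      then have "p + nsmul l x = nsmul c x + nsmul (m - 1) x" using last by (simp add: algebra_simps)
      then have "p + nsmul l x \<in> H" using nsH by (metis nsmul_add)
      then show False using Suc by (simp add: F_def)
    qed
    ultimately show ?case by (simp add: F_def algebra_simps)
  qed (use that in simp)
  have F_down: "p - nsmul l x \<in> F" if "p \<in> F" for p l
  proof -
    obtain c where "- nsmul l x = nsmul c x" using minusH[of l] by (auto simp: H_def)
    then show ?thesis using F_up[OF that, of c] by (metis diff_conv_add_uminus)
  qed
  have PH: "P \<inter> H = (\<lambda>l. nsmul l x) ` {..k}"
    using arc arc_only nsH by (auto simp: H_def)
  have "card (P \<inter> H) = k + 1"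
  proof -
    have "inj_on (\<lambda>l. nsmul l x) {..k}"
      by (rule inj_on_subset[OF m(3)]) (use \<open>k < m\<close> in auto)
    then show ?thesis unfolding PH by (simp add: card_image)
  qed
  then have cardP: "card P = card F + k + 1"
    using card_Int_Diff[OF finP, of H] by (simp add: F_def)
  have cardV: "card V = card W + t"
    unfolding t_def using W fin by (metis card_Diff_subset card_mono finW le_add_diff_inverse)
  have x_outside: "a j = x" if "j \<in> V - W" for j
    using const[OF i that] by (simp add: x_def)
  have sum_outside: "sum a U = nsmul (card U) x" if "U \<subseteq> V - W" for U
    using that x_outside fin by (intro sum_const_nsmul) (auto intro: finite_subset)
  \<comment> \<open>The \<open>t\<close> terms outside \<open>W\<close>, all equal to
    \<open>x\<close>, prolong the arc from \<open>k\<close> to \<open>k + t\<close>. Zero-sum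
    freeness keeps it from closing up, whence \<open>k + t < m\<close>.\<close>
  have arcV: "nsmul l x \<in> subsums a V \<and> (k < l \<longrightarrow> nsmul l x \<noteq> 0)" if "l \<le> k + t" for l
  proof (cases "l \<le> k")
    case True
    then show ?thesis using arc subsums_mono[OF W(2), of a] by (auto simp: P_def)
  next
    case False
    have "l - k \<le> card (V - W)" using \<open>l \<le> k + t\<close> by (simp add: t_def)
    then obtain U where U: "U \<subseteq> V - W" "card U = l - k"
      by (rule obtain_subset_with_card_n)
    have "sum a (W \<union> U) = \<sigma> + sum a U"
      unfolding \<sigma>_def using U finW fin by (intro sum.union_disjoint) (auto intro: finite_subset)
    also have "\<dots> = nsmul l x"
      using False U by (simp add: \<sigma>k sum_outside flip: nsmul_add)
    finally have "sum a (W \<union> U) = nsmul l x" .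
    moreover have "W \<union> U \<subseteq> V" "W \<union> U \<noteq> {}" using W W0 U by auto
    ultimately show ?thesis
      using subsumsI[of "W \<union> U" V a] zero_sum_freeD[OF zsf, of "W \<union> U"] by auto
  qed
  have "k + t < m"
  proof (rule ccontr)
    assume "\<not> k + t < m"
    then show False using arcV[of m] \<open>k < m\<close> m(2) by auto
  qed
  \<comment> \<open>Another coset would give \<open>card F + 2 * m \<le> card G \<le> 2 * card V =
    card F + k + 1 + 2 * t\<close>, impossible for \<open>k + t < m\<close>.\<close>
  have G_eq: "G \<subseteq> F \<union> H"
  proof (rule ccontr)
    assume "\<not> G \<subseteq> F \<union> H"
    then obtain y where y: "y \<in> G" "y \<notin> F" "y \<notin> H" by blast
    let ?Y = "(+) y ` H"
    have "?Y \<inter> F = {}"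
    proof (rule ccontr)
      assume "?Y \<inter> F \<noteq> {}"
      then obtain l where "y + nsmul l x \<in> F" by (auto simp: H_def)
      then show False using F_down[of "y + nsmul l x" l] y by simp
    qed
    moreover have "?Y \<inter> H = {}"
    proof (rule ccontr)
      assume "?Y \<inter> H \<noteq> {}"
      then obtain l c where lc: "l < m" "y + nsmul l x = nsmul c x" by (auto simp: H_def)
      then have "y = nsmul c x + nsmul (m - l) x"
        using nsmul_minus[OF m(2), of l] by (simp add: algebra_simps)
      then show False using y nsH by (metis nsmul_add)
    qed
    ultimately have "card ((F \<union> H) \<union> ?Y) = card F + 2 * m"
      using H finF by (subst card_Un_disjoint) (auto simp: FH card_image)
    moreover have "(F \<union> H) \<union> ?Y \<subseteq> G"
      using H y \<open>P \<subseteq> G\<close> by (auto simp: F_def intro: add_closed)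
    ultimately have "card F + 2 * m \<le> card G" using card_mono[OF finite_G] by metis
    moreover have "card G \<le> card F + k + 1 + 2 * t"
      using long cardV cardP grow[OF i] by simp
    ultimately show False using \<open>k + t < m\<close> by simp
  qed
  then have cardG: "card G = card F + m"
  proof -
    have "G = F \<union> H" using G_eq H \<open>P \<subseteq> G\<close> by (auto simp: F_def)
    then show ?thesis using FH by simp
  qed
  \<comment> \<open>A missing element is \<open>l x\<close> with \<open>k + t < l < m\<close>, that
    is \<open>- c x\<close> with \<open>c = m - l \<le> m - 1 - (k + t)\<close>; this bounds
    \<open>c\<close> by the number of copies of \<open>x\<close>.\<close>
  have bound: "m - 1 - (k + t) \<le> t"
    using long cardV cardP grow[OF i] cardG by simp
  have "t \<le> card {j \<in> V - W0. a j = a i}"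
    unfolding t_def using fin W x_outside by (intro card_mono) (auto simp: x_def)
  then have "m - 1 - (k + t) \<le> card {j \<in> V - W0. a j = a i}" using bound by simp
  have complement: "\<exists>l. k + t < l \<and> l < m \<and> g = nsmul l x" if g: "g \<in> G - subsums a V" for g
  proof -
    have "g \<notin> F" using g subsums_mono[OF W(2), of a] by (auto simp: F_def P_def)
    then obtain l where "l < m" "g = nsmul l x" using g G_eq by (auto simp: H_def)
    moreover have "k + t < l" using arcV[of l] calculation g by (metis DiffD2 not_le)
    ultimately show ?thesis by blast
  qed
  show ?thesis
  proof (intro bexI[of _ i] conjI ballI impI)
    show "i \<in> V - W0" using i W by blast
  next
    fix g assume "g \<in> G - subsums a V"
    then obtain l where l: "k + t < l" "l < m" "g = nsmul l x" using complement by blast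
    have "nsmul (m - (m - l)) x = - nsmul (m - l) x" by (rule nsmul_minus[OF m(2)]) simp
    then have "g = - nsmul (m - l) x" using l by simp
    moreover have "m - l \<le> card {j \<in> V - W0. a j = a i}"
      using l \<open>m - 1 - (k + t) \<le> card {j \<in> V - W0. a j = a i}\<close> by simp
    ultimately show "\<exists>c. 1 \<le> c \<and> c \<le> card {j \<in> V - W0. a j = a i} \<and> g = - nsmul c (a i)"
      using l by (intro exI[of _ "m - l"]) (auto simp: x_def)
  next
    \<comment> \<open>A gap after the arc contains its last point \<open>- x = (m - 1) x\<close>: a
      subsum equal to it would split into a point of \<open>P \<inter> H\<close>, at most
      \<open>k\<close> steps along the arc, and at most \<open>t\<close> copies of
      \<open>x\<close>.\<close>
    assume "subsums a V \<noteq> G"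
    moreover have "subsums a V \<subseteq> G" by (rule subsums_closed[OF aV])
    ultimately obtain g where "g \<in> G - subsums a V" by blast
    then have "k + t < m - 1" using complement by fastforce
    show "- a i \<notin> subsums a V"
    proof
      assume "- a i \<in> subsums a V"
      then obtain A where A: "A \<subseteq> V" "- x = sum a A" by (auto simp: x_def elim: subsumsE)
      have "sum a A = sum a (A \<inter> W) + sum a (A - W)"
        using A fin by (metis finite_subset sum.Int_Diff)
      also have "sum a (A - W) = nsmul (card (A - W)) x"
        using A by (intro sum_outside) auto
      finally have eq: "sum a (A \<inter> W) = - x - nsmul (card (A - W)) x" using A by (simp add: algebra_simps)
      then have "sum a (A \<inter> W) = - nsmul (Suc (card (A - W))) x" by simp
      then have inH: "sum a (A \<inter> W) \<in> H" using minusH by metis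
      have "sum a (A \<inter> W) \<in> P" unfolding P_def by (rule subsumsI) auto
      then obtain l where l: "l \<le> k" "sum a (A \<inter> W) = nsmul l x" using inH PH by auto
      have "card (A - W) \<le> t" unfolding t_def using A fin by (intro card_mono) auto
      then have "l + card (A - W) < m - 1" using l \<open>k + t < m - 1\<close> by simp
      moreover have "nsmul (l + card (A - W)) x = nsmul (m - 1) x"
        using eq l last by (simp add: nsmul_add algebra_simps)
      ultimately show False using inj_onD[OF m(3), of "l + card (A - W)" "m - 1"] by fastforce
    qed
  qed
qed

end

section \<open>Long zero-sum free sequences have small integer representatives\<close>

text \<open>The last clause is the notion of a behaving integer sequence of Savchev and Chen. The
  bound \<open>sum b V < card G\<close> is not built in; for long zero-sum free sequences it follows
  from \<open>light_nonzero\<close> and \<open>generator\<close>.\<close>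

definition light :: "('i \<Rightarrow> 'a::ab_group_add) \<Rightarrow> 'a \<Rightarrow> ('i \<Rightarrow> nat) \<Rightarrow> 'i set \<Rightarrow> bool" where
  "light a x b V \<longleftrightarrow> (\<forall>i\<in>V. 1 \<le> b i \<and> a i = nsmul (b i) x) \<and>
     (\<forall>m\<le>sum b V. \<exists>A\<subseteq>V. sum b A = m)"

lemma light_constant:
  assumes "finite V" "\<And>i. i \<in> V \<Longrightarrow> a i = x"
  shows "light a x (\<lambda>_. 1) V"
proof -
  have "\<exists>A\<subseteq>V. card A = m" if "m \<le> card V" for m
    using that by (meson obtain_subset_with_card_n)
  then show ?thesis using assms by (auto simp: light_def)
qed

text \<open>The intervals from \<open>0\<close> to \<open>sum b V\<close> and from \<open>c\<close>
  to \<open>c + sum b V\<close> leave no gap when \<open>c \<le> Suc (sum b V)\<close>.\<close>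

lemma light_insert:
  assumes L: "light a x b V" and fin: "finite V" "i \<notin> V"
    and c: "a i = nsmul c x" "1 \<le> c" "c \<le> Suc (sum b V)"
  shows "light a x (b(i := c)) (insert i V)"
proof -
  let ?b = "b(i := c)"
  have eq: "sum ?b A = sum b A" if "A \<subseteq> V" for A
    using that fin by (intro sum.cong) auto
  have tot: "sum ?b (insert i V) = c + sum b V"
    using fin eq[of V] by simp
  have "\<exists>A\<subseteq>insert i V. sum ?b A = m" if m: "m \<le> c + sum b V" for m
  proof (cases "m \<le> sum b V")
    case True
    then obtain A where "A \<subseteq> V" "sum b A = m" using L by (auto simp: light_def)
    then show ?thesis using eq by (intro exI[of _ A]) auto
  next
    case False
    then have "m - c \<le> sum b V" "c \<le> m" using m c by auto
    then obtain A where A: "A \<subseteq> V" "sum b A = m - c" using L by (auto simp: light_def)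
    then have "sum ?b (insert i A) = c + sum ?b A"
      using fin finite_subset[OF A(1)] by (subst sum.insert) auto
    then have "sum ?b (insert i A) = m"
      using eq[OF A(1)] A(2) \<open>c \<le> m\<close> by simp
    then show ?thesis using A by (intro exI[of _ "insert i A"]) auto
  qed
  moreover have "\<forall>j\<in>insert i V. 1 \<le> ?b j \<and> a j = nsmul (?b j) x"
    using L c by (auto simp: light_def)
  ultimately show ?thesis unfolding light_def tot by blast
qed

lemma light_subset_sum:
  assumes "light a x b V" "finite V" "A \<subseteq> V"
  shows "sum a A = nsmul (sum b A) x"
  using assms by (intro sum_nsmul) (auto simp: light_def intro: finite_subset)

lemma light_subsums:
  assumes "light a x b V" "finite V"
  shows "subsums a V = (\<lambda>m. nsmul m x) ` {..sum b V}"
proof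
  show "subsums a V \<subseteq> (\<lambda>m. nsmul m x) ` {..sum b V}"
  proof
    fix p assume "p \<in> subsums a V"
    then obtain A where A: "A \<subseteq> V" "p = sum a A" by (rule subsumsE)
    have "sum b A \<le> sum b V" using assms(2) A by (intro sum_mono2) auto
    then show "p \<in> (\<lambda>m. nsmul m x) ` {..sum b V}"
      using light_subset_sum[OF assms A(1)] A(2) by blast
  qed
  show "(\<lambda>m. nsmul m x) ` {..sum b V} \<subseteq> subsums a V"
  proof
    fix p assume "p \<in> (\<lambda>m. nsmul m x) ` {..sum b V}"
    then obtain m where "m \<le> sum b V" "p = nsmul m x" by auto
    moreover then obtain A where "A \<subseteq> V" "sum b A = m" using assms by (auto simp: light_def)
    ultimately show "p \<in> subsums a V"
      using light_subset_sum[OF assms] subsumsI by metis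
  qed
qed

text \<open>This supplies the order hypothesis of \<open>generator\<close> with
  \<open>s = sum b V\<close>.\<close>

lemma light_nonzero:
  assumes "light a x b V" "finite V" "zero_sum_free a V" "0 < m" "m \<le> sum b V"
  shows "nsmul m x \<noteq> 0"
proof -
  obtain A where A: "A \<subseteq> V" "sum b A = m" using assms by (auto simp: light_def)
  then have "A \<noteq> {}" using assms(4) by auto
  then show ?thesis
    using light_subset_sum[OF assms(1,2) A(1)] zero_sum_freeD[OF assms(3) A(1)] A(2) by simp
qed

lemma light_card_le:
  assumes "light a x b V"
  shows "card V \<le> sum b V"
  using sum_mono[of V "\<lambda>_. 1" b] assms by (simp add: light_def)

context finite_add_subgroup
begin

text \<open>The missing elements reveal the generator: they are \<open>- nsmul c x\<close> with
  \<open>c\<close> at most the multiplicity of one term \<open>x\<close>. The copies of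
  \<open>x\<close> are enlarged to a maximal light \<open>L\<close>; a term left over is refuted by
  a second use of \<open>long_zero_sum_free_complement\<close>.\<close>

lemma light_if_not_all_subsums:
  assumes fin: "finite V" and aV: "a ` V \<subseteq> G" and zsf: "zero_sum_free a V"
    and long: "card G \<le> 2 * card V" and "subsums a V \<noteq> G"
  obtains x b where "x \<in> G" "light a x b V"
proof -
  have "subsums a V \<subset> G" using assms by (simp add: subsums_closed psubsetI)
  then have "card (subsums a V) < card G" by (simp add: psubset_card_mono)
  then have small: "card (subsums a V) < 2 * card V" using long by simp
  have "V \<noteq> {}" using long card_G_pos by auto
  then obtain i0 where i0: "i0 \<in> V" by blast
  have "2 * card {i0} \<le> card (subsums a {i0})"
    using card_less_subsums[of "{i0}" a] zero_sum_free_subset[OF zsf, of "{i0}"] i0 by simp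
  moreover have "{i0} \<subseteq> V" "{i0} \<noteq> {}" using i0 by auto
  ultimately obtain i1 where "i1 \<in> V - {i0}" and compl:
    "\<And>g. g \<in> G - subsums a V \<Longrightarrow> \<exists>c. 1 \<le> c \<and> c \<le> card {j \<in> V - {i0}. a j = a i1} \<and> g = - nsmul c (a i1)"
    using long_zero_sum_free_complement[OF fin aV zsf long small, of "{i0}"] by blast
  then have i1: "i1 \<in> V" by blast
  define x where "x = a i1"
  define X where "X = {j \<in> V. a j = x}"
  have mult: "card {j \<in> V - {i0}. a j = a i1} \<le> card X"
    unfolding X_def x_def using fin by (intro card_mono) auto
  let ?Q = "\<lambda>L. X \<subseteq> L \<and> L \<subseteq> V \<and> (\<exists>b. light a x b L)"
  have "light a x (\<lambda>_. 1) X"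
    by (rule light_constant) (use fin in \<open>auto simp: X_def\<close>)
  then have "?Q X" by (auto simp: X_def)
  then have "\<exists>L. ?Q L \<and> (\<forall>L'. ?Q L' \<longrightarrow> card L' \<le> card L)"
    using card_mono[OF fin]
    by (intro ex_has_greatest_nat[of ?Q X card "Suc (card V)"]) (simp_all add: le_imp_less_Suc)
  then obtain L b where L: "X \<subseteq> L" "L \<subseteq> V" "light a x b L"
    and max: "\<And>L'. ?Q L' \<Longrightarrow> card L' \<le> card L" by blast
  have finL: "finite L" using L fin finite_subset by blast
  have zsfL: "zero_sum_free a L" using zero_sum_free_subset[OF zsf] L by blast
  have not_absorbed: "c > Suc (sum b L)" if "j \<in> V - L" "a j = nsmul c x" for j c
  proof (rule ccontr)
    assume "\<not> c > Suc (sum b L)"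
    moreover have "c \<noteq> 0" using zero_sum_free_nonzero[OF zsf, of j] that by (metis DiffD1 nsmul.simps(1))
    ultimately have "light a x (b(j := c)) (insert j L)"
      using light_insert[OF L(3) finL, of j c] that by simp
    then have "card (insert j L) \<le> card L" using L that by (intro max) auto
    then show False using that finL by auto
  qed
  have "L = V"
  proof (rule ccontr)
    assume "L \<noteq> V"
    then obtain z where z: "z \<in> V - L" using L by blast
    \<comment> \<open>A coincidence would make \<open>- a z\<close> a subsum of \<open>L\<close>, or
      \<open>a z\<close> a multiple of \<open>x\<close> small enough to be absorbed. Disjointness
      doubles the number of subsums, which qualifies \<open>insert z L\<close> as a new
      \<open>W0\<close>.\<close>
    have disj: "subsums a L \<inter> (+) (a z) ` subsums a L = {}"
    proof (rule ccontr)
      assume "subsums a L \<inter> (+) (a z) ` subsums a L \<noteq> {}"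
      then obtain i j where ij: "i \<le> sum b L" "j \<le> sum b L" "nsmul i x = a z + nsmul j x"
        unfolding light_subsums[OF L(3) finL] by auto
      show False
      proof (cases "i \<le> j")
        case True
        then have "- a z = nsmul (j - i) x" using ij by (simp add: nsmul_diff)
        moreover have "nsmul (j - i) x \<in> subsums a L"
          using ij unfolding light_subsums[OF L(3) finL] by auto
        ultimately show False
          using uminus_notin_subsums[OF finL, of z a] zero_sum_free_subset[OF zsf, of "insert z L"] z L by auto
      next
        case False
        then have "a z = nsmul (i - j) x" using ij by (simp add: nsmul_diff)
        then show False using not_absorbed[OF z] ij by fastforce
      qed
    qed
    have "card (subsums a (insert z L)) = 2 * card (subsums a L)"
      using subsums_insert[OF finL, of z a] z disj finL by (simp add: card_Un_disjoint card_image)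
    then have "2 * card (insert z L) \<le> card (subsums a (insert z L))"
      using card_less_subsums[OF finL zsfL] z finL by simp
    moreover have "insert z L \<subseteq> V" using z L by blast
    ultimately obtain i where i: "i \<in> V - insert z L" "- a i \<notin> subsums a V"
      using assms(5) long_zero_sum_free_complement[OF fin aV zsf long small, of "insert z L"] by blast
    \<comment> \<open>As a missing element, \<open>- a i\<close> is some \<open>- nsmul c x\<close>
      with \<open>c \<le> card X\<close>; but then \<open>i\<close> could have been absorbed into
      \<open>L\<close>.\<close>
    have "- a i \<in> G" using i aV by (auto intro: uminus_closed)
    then obtain c where c: "1 \<le> c" "c \<le> card X" "- a i = - nsmul c x"
      using compl[of "- a i"] i mult by (auto simp: x_def)
    have "card X \<le> card L" using L finL by (intro card_mono)
    then have "c \<le> sum b L" using c light_card_le[OF L(3)] by simp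
    then show False using not_absorbed[of i c] i c by simp
  qed
  then show thesis using that L i1 aV by (auto simp: x_def)
qed

text \<open>Drop a term \<open>i\<close>: the others miss the subsum \<open>- a i\<close>, so they
  are light. In \<open>a i = nsmul c x\<close> the coefficient is at most their total, since
  otherwise \<open>- a i = nsmul (card G - c) x\<close> would be one of their subsums.\<close>

lemma light_if_long:
  assumes fin: "finite V" and aV: "a ` V \<subseteq> G" and zsf: "zero_sum_free a V"
    and long: "card G + 2 \<le> 2 * card V"
  obtains x b where "x \<in> G" "light a x b V"
proof -
  have "V \<noteq> {}" using long by auto
  then obtain i where i: "i \<in> V" by blast
  let ?V = "V - {i}"
  have V: "finite ?V" "a ` ?V \<subseteq> G" "i \<notin> ?V" "insert i ?V = V" using fin aV i by auto
  have zsf': "zero_sum_free a ?V" using zero_sum_free_subset[OF zsf] by blast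
  have long': "card G \<le> 2 * card ?V" using long i fin by simp
  have ni: "- a i \<notin> subsums a ?V" using uminus_notin_subsums[OF V(1,3)] V(4) zsf by simp
  moreover have "- a i \<in> G" using i aV by (auto intro: uminus_closed)
  ultimately obtain x b where x: "x \<in> G" "light a x b ?V"
    using light_if_not_all_subsums[OF V(1,2) zsf' long'] by metis
  let ?s = "sum b ?V"
  have s: "card G \<le> 2 * ?s" using long' light_card_le[OF x(2)] by simp
  have gen: "?s < card G" "\<And>m. nsmul m x = 0 \<longleftrightarrow> card G dvd m"
    "\<And>g. g \<in> G \<Longrightarrow> \<exists>m<card G. g = nsmul m x"
    using generator[OF x(1), of ?s] light_nonzero[OF x(2) V(1) zsf'] s by auto
  obtain c where c: "c < card G" "a i = nsmul c x" using gen(3)[of "a i"] i aV by auto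
  have "c \<le> ?s"
  proof (rule ccontr)
    assume "\<not> c \<le> ?s"
    have "nsmul (card G - c) x = - nsmul c x"
      using nsmul_minus[of "card G" x c] gen(2)[of "card G"] c by simp
    moreover have "nsmul (card G - c) x \<in> subsums a ?V"
      unfolding light_subsums[OF x(2) V(1)] using \<open>\<not> c \<le> ?s\<close> s by (intro imageI) simp
    ultimately show False using ni c by simp
  qed
  moreover have "c \<noteq> 0" using zero_sum_free_nonzero[OF zsf i] c by (metis nsmul.simps(1))
  ultimately have "light a x (b(i := c)) V"
    using light_insert[OF x(2) V(1,3) c(2)] V(4) by simp
  then show thesis using that x by blast
qed

text \<open>Two distinct terms already have four subsums and every further term adds one, giving
  \<open>card V + 2 > card G\<close> subsums. This serves the case of a term \<open>0\<close>, where
  the other \<open>n - 1\<close> terms are zero-sum free.\<close>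

lemma constant_if_length_maximal:
  assumes fin: "finite V" and aV: "a ` V \<subseteq> G" and zsf: "zero_sum_free a V"
    and "card G \<le> card V + 1" "i \<in> V" "j \<in> V"
  shows "a i = a j"
proof (rule ccontr)
  assume ne: "a i \<noteq> a j"
  then have "i \<noteq> j" by auto
  have "a i \<noteq> 0" "a j \<noteq> 0" "a i + a j \<noteq> 0"
    using zero_sum_free_nonzero[OF zsf] zero_sum_freeD[OF zsf, of "{i, j}"] assms(5,6) \<open>i \<noteq> j\<close> by auto
  then have "card {0, a i, a j, a i + a j} = 4" using ne by auto
  moreover have "{0, a i, a j, a i + a j} \<subseteq> subsums a {i, j}"
    using subsumsI[of "{}" "{i, j}" a] subsumsI[of "{i}" "{i, j}" a] subsumsI[of "{j}" "{i, j}" a]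
      subsumsI[of "{i, j}" "{i, j}" a] \<open>i \<noteq> j\<close> by simp
  ultimately have "4 \<le> card (subsums a {i, j})"
    using card_mono[of "subsums a {i, j}" "{0, a i, a j, a i + a j}"] by simp
  moreover have "card (subsums a {i, j}) + card (V - {i, j}) \<le> card (subsums a V)"
    using card_subsums_mono[OF fin _ zsf, of "{i, j}"] assms(5,6) by simp
  moreover have "card (V - {i, j}) = card V - 2"
    using assms(5,6) fin \<open>i \<noteq> j\<close> by (simp add: card_Diff_subset)
  moreover have "card (subsums a V) \<le> card G"
    using subsums_closed[OF aV] by (intro card_mono) auto
  ultimately show False using assms(4) by simp
qed

end

section \<open>Sequences containing many ones\<close>

lemma card_image_le_2:
  assumes "\<And>i. i \<in> I \<Longrightarrow> f i = x \<or> f i = y"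
  shows "card (f ` I) \<le> 2"
proof -
  have "f ` I \<subseteq> {x, y}" using assms by blast
  then have "card (f ` I) \<le> card {x, y}" by (intro card_mono) auto
  also have "\<dots> \<le> 2" by (simp add: card_insert_if)
  finally show ?thesis .
qed

text \<open>For \<open>t\<close> outside the maximal \<open>V\<close>, all ways of writing \<open>n - b t\<close> as a subsum of \<open>V\<close> use the
  same number of terms.  As \<open>V\<close> contains many ones, exchanging a term \<open>y > 1\<close> for \<open>y\<close> ones forces
  \<open>n - b t\<close> to be very close to one of the ends of \<open>{0..sum b V}\<close>.\<close>

lemma at_most_two_residues:
  fixes b :: "'i \<Rightarrow> nat"
  assumes fin: "finite I" and cardI: "card I = n"
    and range: "\<And>i. i \<in> I \<Longrightarrow> 1 \<le> b i \<and> b i < n"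
    and zs: "\<And>J. J \<subseteq> I \<Longrightarrow> J \<noteq> {} \<Longrightarrow> n dvd sum b J \<Longrightarrow> card J = r"
    and V: "V \<subseteq> I" "sum b V < n"
    and max: "\<And>W. W \<subseteq> I \<Longrightarrow> sum b W < n \<Longrightarrow> card W \<le> card V"
    and long: "n \<le> card V + r"
    and ones: "(\<forall>i\<in>V. b i = 1) \<or> (n \<le> 2 * card V \<and> sum b V + 2 \<le> 2 * card V \<and>
      (sum b V + 3 \<le> 2 * card V \<or> sum b V \<le> 2 * card {i \<in> V. b i = 1} + 1))"
  shows "card (b ` I) \<le> 2"
proof -
  define O1 where "O1 = {i \<in> V. b i = 1}"
  define Y where "Y = V - O1"
  define a where "a = card O1"
  define s where "s = sum b V"
  define v where "v = card V"
  define l where "l = card Y"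
  have finV: "finite V" using V fin finite_subset by blast
  have finO: "finite O1" "finite Y" and VY: "V = O1 \<union> Y" "O1 \<inter> Y = {}"
    using finV by (auto simp: O1_def Y_def)
  have sumO: "sum b C = card C" if "C \<subseteq> O1" for C
  proof -
    have "sum b C = (\<Sum>i\<in>C. 1)" using that by (intro sum.cong) (auto simp: O1_def)
    then show ?thesis by simp
  qed
  have v: "v = a + l" and s: "s = a + sum b Y"
    using card_Un_disjoint[OF finO VY(2)] sum.union_disjoint[OF finO VY(2), of b] VY(1) sumO[of O1]
    by (simp_all add: v_def a_def l_def s_def)
  have "s < n" using V by (simp add: s_def)
  have cardO: "card (I - V) = n - v"
    using V fin cardI finV by (simp add: card_Diff_subset v_def)
  \<comment> \<open>Zero sums are encoded by the terms \<open>X\<close> outside \<open>V\<close>,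
    the terms \<open>B\<close> of \<open>V\<close> above one, and the number \<open>u\<close> of
    ones; each feasible triple is an equation for \<open>r\<close>.\<close>
  have key: "card X + card B + u = r"
    if XB: "X \<subseteq> I - V" "B \<subseteq> Y" "u \<le> a" "X \<noteq> {}" "n dvd sum b X + sum b B + u" for X B u
  proof -
    obtain C where C: "C \<subseteq> O1" "card C = u"
      using XB(3) obtain_subset_with_card_n unfolding a_def by metis
    have f: "finite X" "finite B" "finite C"
      using XB C fin finO by (auto intro: finite_subset)
    have d: "X \<inter> (B \<union> C) = {}" "B \<inter> C = {}"
      using XB C VY by auto
    have "sum b (X \<union> (B \<union> C)) = sum b X + sum b B + u"
      using f d sumO[OF C(1)] C(2) by (simp add: sum.union_disjoint)
    moreover have "card (X \<union> (B \<union> C)) = card X + card B + u"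
      using f d C(2) by (simp add: card_Un_disjoint)
    moreover have "X \<union> (B \<union> C) \<subseteq> I" "X \<union> (B \<union> C) \<noteq> {}" using XB C VY V by auto
    ultimately show ?thesis using zs[of "X \<union> (B \<union> C)"] XB(5) by simp
  qed
  have key1: "card B + u + 1 = r"
    if "t \<in> I - V" "B \<subseteq> Y" "u \<le> a" "sum b B + u + b t = n" for t B u
  proof -
    have "b t + sum b B + u = n" using that(4) by simp
    then have "n dvd b t + sum b B + u" by simp
    then show ?thesis using key[of "{t}" B u] that by simp
  qed
  have outside: "n \<le> s + b t \<and> b t < n" if "t \<in> I - V" for t
  proof -
    have "\<not> sum b (insert t V) < n"
    proof
      assume "sum b (insert t V) < n"
      then have "card (insert t V) \<le> card V" using that V by (intro max) auto
      then show False using that finV by simp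
    qed
    then show ?thesis using that finV range[of t] by (auto simp: s_def)
  qed
  show ?thesis
  proof (cases "Y = {}")
    case True
    have "b t = n + 1 - r" if "t \<in> I - V" for t
    proof -
      have "card ({} :: 'i set) + (n - b t) + 1 = r"
        using outside[OF that] True s by (intro key1[OF that]) auto
      then show ?thesis using outside[OF that] by auto
    qed
    then show ?thesis
      using True by (intro card_image_le_2[of _ b 1 "n + 1 - r"]) (auto simp: Y_def O1_def)
  next
    case False
    have twoY: "b i \<ge> 2" if "i \<in> Y" for i
      using that range[of i] V by (auto simp: Y_def O1_def)
    have sumY: "2 * card Z \<le> sum b Z" if "Z \<subseteq> Y" for Z
    proof -
      have "(\<Sum>i\<in>Z. 2) \<le> sum b Z" using twoY that by (intro sum_mono) auto
      then show ?thesis by simp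
    qed
    have "\<not> (\<forall>i\<in>V. b i = 1)" using False by (auto simp: Y_def O1_def)
    \<comment> \<open>\<open>s + 2 \<le> 2 * v\<close> yields \<open>single\<close> and
      \<open>s + 3 \<le> 2 * v\<close> yields \<open>pair\<close>. The alternative
      \<open>s \<le> 2 * a + 1\<close> instead empties the middle range \<open>a < c\<close>,
      \<open>c + a < s\<close> below.\<close>
    then have cond: "n \<le> 2 * v" "s + 2 \<le> 2 * v" "s + 3 \<le> 2 * v \<or> s \<le> 2 * a + 1"
      using ones by (auto simp: s_def v_def a_def O1_def)
    have l: "l \<ge> 1" using False finO by (simp add: l_def Suc_leI card_gt_0_iff)
    have rest: "sum b Y = b y + sum b (Y - {y})" "card (Y - {y}) = l - 1"
        "b y + 2 * l \<le> sum b Y + 2" if "y \<in> Y" for y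
    proof -
      show 1: "sum b Y = b y + sum b (Y - {y})" using that finO by (simp add: sum.remove)
      show 2: "card (Y - {y}) = l - 1" using that finO by (simp add: l_def)
      show "b y + 2 * l \<le> sum b Y + 2"
        using sumY[of "Y - {y}"] 1 2 l by fastforce
    qed
    have single: "b y \<le> a" if "y \<in> Y" for y
      using rest(3)[OF that] cond v s by linarith
    have pair: "b y + b z \<le> a + 1" if "y \<in> Y" "z \<in> Y" "y \<noteq> z" "s + 3 \<le> 2 * v" for y z
    proof -
      have "sum b (Y - {y}) = b z + sum b (Y - {y} - {z})" using that finO by (simp add: sum.remove)
      moreover have "card (Y - {y} - {z}) = l - 2" using that finO by (simp add: l_def)
      moreover have "2 * card (Y - {y} - {z}) \<le> sum b (Y - {y} - {z})" by (rule sumY) auto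
      ultimately show ?thesis using rest(1)[OF that(1)] that(4) v s by linarith
    qed
    have ends: "(\<forall>y\<in>Y. n < b y + b t) \<or> (\<forall>y\<in>Y. s + b t < b y + n)" if t: "t \<in> I - V" for t
    proof (rule ccontr)
      assume "\<not> ?thesis"
      then obtain y z where yz: "y \<in> Y" "b y + b t \<le> n" "z \<in> Y" "b z + n \<le> s + b t"
        by (auto simp: not_less)
      \<comment> \<open>Two expressions of \<open>c\<close> with different lengths are sought: for
        \<open>c \<le> a\<close>, ones alone against \<open>y\<close> and ones; near
        \<open>s\<close>, all of \<open>Y\<close> against \<open>Y - {z}\<close>, each filled up
        with ones.\<close>
      define c where "c = n - b t"
      have c: "c + b t = n" "c \<le> s" "b y \<le> c" "b z + c \<le> s"
        using outside[OF t] yz by (auto simp: c_def)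
      consider "c \<le> a" | "s \<le> c + a" | "a < c" "c + a < s" by linarith
      then show False
      proof cases
        case 1
        have "card ({} :: 'i set) + c + 1 = r" using c 1 by (intro key1[OF t]) auto
        moreover have "card {y} + (c - b y) + 1 = r" using c 1 yz by (intro key1[OF t]) auto
        ultimately show False using twoY[OF yz(1)] c by simp
      next
        case 2
        have "card Y + (a + c - s) + 1 = r" using c 2 s by (intro key1[OF t]) auto
        moreover have "card (Y - {z}) + (a + c + b z - s) + 1 = r"
          using c 2 s yz rest(1)[OF yz(3)] by (intro key1[OF t]) auto
        ultimately show False using twoY[OF yz(3)] rest(2)[OF yz(3)] l 2 by (simp add: l_def)
      next
        case 3
        then have big: "s + 3 \<le> 2 * v" using cond by linarith
        \<comment> \<open>A \<open>B\<close> of maximal size leaves a gap \<open>c - sum b B\<close>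
          less than \<open>b y'\<close>. By \<open>pair\<close> the gap plus any \<open>b x\<close>
          is at most \<open>a\<close>, so \<open>x\<close> in \<open>B\<close> can be replaced by
          \<open>b x\<close> ones.\<close>
        let ?Q = "\<lambda>B. B \<subseteq> Y \<and> sum b B \<le> c"
        have "\<exists>B. ?Q B \<and> (\<forall>B'. ?Q B' \<longrightarrow> card B' \<le> card B)"
          using card_mono[OF finO(2)]
          by (intro ex_has_greatest_nat[of ?Q "{}" card "Suc l"]) (simp_all add: l_def le_imp_less_Suc)
        then obtain B where B: "B \<subseteq> Y" "sum b B \<le> c" and Bmax: "\<And>B'. ?Q B' \<Longrightarrow> card B' \<le> card B"
          by blast
        have finB: "finite B" using B finO finite_subset by blast
        have "B \<noteq> Y" using B 3 s by auto
        then obtain y' where y': "y' \<in> Y" "y' \<notin> B" using B by blast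
        have exceed: "c < sum b B + b y'"
        proof (rule ccontr)
          assume "\<not> c < sum b B + b y'"
          then have "card (insert y' B) \<le> card B" using y' B finB by (intro Bmax) auto
          then show False using y' finB by simp
        qed
        have "B \<noteq> {}" using Bmax[of "{y}"] yz c by auto
        then obtain x where x: "x \<in> B" by blast
        have "b x + b y' \<le> a + 1" using x y' B big by (intro pair) auto
        moreover have "sum b B = b x + sum b (B - {x})" using x finB by (simp add: sum.remove)
        ultimately have less: "c + b x \<le> a + sum b B" "sum b (B - {x}) + b x = sum b B"
          using exceed by simp_all
        have "2 \<le> b x" using twoY x B by blast
        have "card B + (c - sum b B) + 1 = r"
        proof (rule key1[OF t B(1)])
          show "c - sum b B \<le> a" using less by linarith
          show "sum b B + (c - sum b B) + b t = n" using B c by linarith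
        qed
        moreover have "card (B - {x}) + (c + b x - sum b B) + 1 = r"
        proof (rule key1[OF t])
          show "B - {x} \<subseteq> Y" using B by blast
          show "c + b x - sum b B \<le> a" using less by linarith
          show "sum b (B - {x}) + (c + b x - sum b B) + b t = n" using less B c by linarith
        qed
        moreover have "card B = Suc (card (B - {x}))" using card_Suc_Diff1[OF finB x] by simp
        ultimately show False using \<open>2 \<le> b x\<close> B(2) by linarith
      qed
    qed
    have excess: "v + b y + l \<le> s + 2" if "y \<in> Y" for y
      using rest(3)[OF that] v s by linarith
    \<comment> \<open>Replacing \<open>y\<close> by \<open>t\<close> and \<open>t'\<close> gives one
      term more than \<open>V\<close> has, so by maximality the sum reaches
      \<open>n\<close>.\<close>
    have swap: "n + b y \<le> s + b t + b t'" if "y \<in> Y" "t \<in> I - V" "t' \<in> I - V" "t \<noteq> t'" for y t t'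
    proof -
      let ?W = "insert t (insert t' (V - {y}))"
      have "y \<in> V" using that by (simp add: Y_def)
      have "card ?W = v + 1"
        using that finV \<open>y \<in> V\<close> card_gt_0_iff[of V] by (auto simp: v_def card_insert_if)
      then have "\<not> sum b ?W < n" using max[of ?W] that V by (auto simp: v_def)
      moreover have "sum b ?W = b t + (b t' + sum b (V - {y}))" using that finV by auto
      moreover have "s = b y + sum b (V - {y})" using \<open>y \<in> V\<close> finV by (simp add: s_def sum.remove)
      ultimately show ?thesis by simp
    qed
    show ?thesis
    proof (cases "\<exists>t\<in>I - V. \<forall>y\<in>Y. n < b y + b t")
      case True
      \<comment> \<open>This case is contradictory. Here \<open>n - b u\<close> lies below all of
        \<open>Y\<close> and is a sum of ones only, so \<open>b u = n + 1 - r\<close>; this makes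
        all estimates sharp, with a single \<open>y\<close> of value \<open>r\<close>. Every other
        outside term is then \<open>n + 2 - 2 * r\<close>.\<close>
      then obtain u where u: "u \<in> I - V" "\<forall>y\<in>Y. n < b y + b u" by blast
      obtain y where y: "y \<in> Y" using False by blast
      have first: "b t + r = n + 1" if "t \<in> I - V" "\<forall>y\<in>Y. n < b y + b t" for t
      proof -
        have "n < b y + b t" using that(2) y by blast
        then have "card ({} :: 'i set) + (n - b t) + 1 = r"
          using outside[OF that(1)] single[OF y] by (intro key1[OF that(1)]) auto
        then show ?thesis using outside[OF that(1)] by auto
      qed
      have bu: "b u + r = n + 1" by (rule first[OF u])
      have tight: "l = 1" "s + 1 = n" "b y = r" "v + r = n"
        using excess[OF y] long l \<open>s < n\<close> u(2) y bu v_def by force+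
      then have "card Y = 1" by (simp add: l_def)
      then have Y: "Y = {y}" using y by (metis card_1_singletonE singletonD)
      have a: "a + r + 1 = n" using v tight by simp
      have "r \<le> a" using single[OF y] tight by simp
      have "r \<ge> 2" using twoY[OF y] tight by simp
      have second: "b t + 2 * r = n + 2 \<and> n + 1 < 3 * r" if t: "t \<in> I - V" "t \<noteq> u" for t
      proof -
        have "\<not> (\<forall>y\<in>Y. n < b y + b t)"
        proof
          assume "\<forall>y\<in>Y. n < b y + b t"
          then have bt: "b t + r = n + 1" by (rule first[OF t(1)])
          \<comment> \<open>The sum is \<open>2 * n\<close>, but the number of terms is
            \<open>r + 1\<close>.\<close>
          have "sum b {u, t} + sum b {y} + (r - 2) = 2 * n"
            using bt bu t tight \<open>r \<ge> 2\<close> by simp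
          then have "card {u, t} + card {y} + (r - 2) = r"
            using t u y \<open>r \<le> a\<close> by (intro key) auto
          then show False using t \<open>r \<ge> 2\<close> by simp
        qed
        then have lt: "s + b t < b y + n" using ends[OF t(1)] y by auto
        then have "card Y + (a + n - (s + b t)) + 1 = r"
          using outside[OF t(1)] s Y tight a \<open>r \<le> a\<close> by (intro key1[OF t(1)]) auto
        then have "2 + (a + n - (s + b t)) = r" using Y by simp
        then show ?thesis using lt tight a \<open>r \<le> a\<close> by linarith
      qed
      have "r \<ge> 3"
      proof (rule ccontr)
        assume "\<not> r \<ge> 3"
        then have "r = 2" using \<open>r \<ge> 2\<close> by simp
        have "card (I - V - {u}) = r - 1" using u cardO tight fin by (simp add: card_Diff_subset)
        then obtain t where "t \<in> I - V - {u}" using \<open>r = 2\<close> by (metis card.empty equals0I one_neq_zero diff_add_inverse one_add_one)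
        then show False using second[of t] \<open>r = 2\<close> \<open>r \<le> a\<close> a by simp
      qed
      have "card (I - V - {u}) = r - 1" using u cardO tight fin by (simp add: card_Diff_subset)
      then have "2 \<le> card (I - V - {u})" using \<open>r \<ge> 3\<close> by simp
      then obtain T where T: "T \<subseteq> I - V - {u}" "card T = 2" by (rule obtain_subset_with_card_n)
      then obtain t t' where t: "T = {t, t'}" "t \<noteq> t'" by (meson card_2_iff)
      have bt: "b t + 2 * r = n + 2" "b t' + 2 * r = n + 2" "n + 1 < 3 * r"
        using second[of t] second[of t'] T t by auto
      have sw: "n + b y \<le> s + b t + b t'" using y T t by (intro swap) auto
      \<comment> \<open>Ones complete \<open>b t + b t' = 2 * (n + 2 - 2 * r)\<close> to
        \<open>n\<close>; the length of this zero sum yields \<open>n + 2 = 3 * r\<close>.\<close>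
      have "card {t, t'} + card ({} :: 'i set) + (4 * r - 4 - n) = r"
      proof (rule key)
        have "sum b {t, t'} = b t + b t'" using t by simp
        then have "sum b {t, t'} + (4 * r - 4 - n) = n"
          using bt \<open>r \<ge> 3\<close> by linarith
        then show "n dvd sum b {t, t'} + sum b ({} :: 'i set) + (4 * r - 4 - n)" by simp
        show "4 * r - 4 - n \<le> a" using bt sw tight a by linarith
      qed (use T t in auto)
      then have "2 + (4 * r - 4 - n) = r" using t by simp
      then have nr: "n + 2 = 3 * r" using bt by linarith
      \<comment> \<open>With \<open>n + 2 = 3 * r\<close> this sum is \<open>2 * n\<close>, again
        with \<open>r + 1\<close> terms.\<close>
      have "card {u, t, t'} + card {y} + (r - 3) = r"
      proof (rule key)
        have "sum b {u, t, t'} = b u + b t + b t'" using T t by auto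
        then have "sum b {u, t, t'} + sum b {y} + (r - 3) = 2 * n"
          using bu bt nr tight(3) \<open>r \<ge> 3\<close> by simp
        then show "n dvd sum b {u, t, t'} + sum b {y} + (r - 3)" by simp
      qed (use T t u y \<open>r \<le> a\<close> in auto)
      moreover have "card {u, t, t'} = 3" using T t by auto
      ultimately have False using \<open>r \<ge> 3\<close> by simp
      then show ?thesis ..
    next
      case no_first: False
      \<comment> \<open>Every \<open>n - b t\<close> is now so close to \<open>s\<close> that it
        arises from \<open>V\<close> by removing ones only. The length then fixes the same
        \<open>b t\<close> for all outside terms.\<close>
      have second: "s + b t < b y + n" if "t \<in> I - V" "y \<in> Y" for t y
        using ends[OF that(1)] no_first that by blast
      have eq: "v + n + 1 = s + b t + r" if t: "t \<in> I - V" for t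
      proof -
        obtain y where y: "y \<in> Y" using False by blast
        have le: "s + b t \<le> a + n" using second[OF t y] single[OF y] by simp
        then have "card Y + (a + n - (s + b t)) + 1 = r"
          using outside[OF t] s by (intro key1[OF t]) auto
        then show ?thesis using le v by (simp add: l_def)
      qed
      obtain y0 where y0: "y0 \<in> Y" using False by blast
      have "2 \<le> card (I - V)"
        using cardO excess[OF y0] twoY[OF y0] l \<open>s < n\<close> by simp
      then obtain T where T: "T \<subseteq> I - V" "card T = 2" by (rule obtain_subset_with_card_n)
      then obtain t t' where t: "T = {t, t'}" "t \<noteq> t'" by (meson card_2_iff)
      have tt: "t \<in> I - V" "t' \<in> I - V" using T t by auto
      have bt: "b t' = b t" using eq[OF tt(1)] eq[OF tt(2)] by simp
      \<comment> \<open>Trading \<open>y\<close> and \<open>\<delta>\<close> ones for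
        \<open>t\<close> and \<open>t'\<close> turns \<open>V\<close> into a zero sum; comparing its
        length with \<open>eq\<close> identifies \<open>b y\<close> with \<open>b t\<close>.\<close>
      have inside: "b y = b t" if y: "y \<in> Y" for y
      proof -
        have "n + b y \<le> s + b t + b t" using swap[OF y tt t(2)] bt by simp
        then obtain \<delta> where \<delta>: "s + b t + b t = n + b y + \<delta>"
          using le_iff_add by blast
        have "\<delta> \<le> a"
          using \<delta> second[OF tt(1) y] cond rest(3)[OF y] v s by linarith
        then obtain w where w: "a = \<delta> + w" using le_iff_add by blast
        have "sum b {t, t'} = b t + b t" using t bt by simp
        then have n: "sum b {t, t'} + sum b (Y - {y}) + w = n"
          using rest(1)[OF y] s \<delta> w by linarith
        have "card {t, t'} + card (Y - {y}) + w = r"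
        proof (rule key)
          show "n dvd sum b {t, t'} + sum b (Y - {y}) + w" unfolding n by simp
        qed (use tt w in auto)
        then have "l + 1 + w = r" using t rest(2)[OF y] l by simp
        then show ?thesis using eq[OF tt(1)] v w \<delta> by linarith
      qed
      show ?thesis
      proof (rule card_image_le_2)
        fix i assume i: "i \<in> I"
        consider "i \<in> O1" | "i \<in> Y" | "i \<in> I - V" using i VY by blast
        then show "b i = 1 \<or> b i = b t"
        proof cases
          case 3
          then show ?thesis using eq[OF 3] eq[OF tt(1)] by simp
        qed (use inside in \<open>auto simp: O1_def\<close>)
      qed
    qed
  qed
qed

section \<open>Cyclic groups and the final argument\<close>

context finite_add_subgroup
begin

text \<open>Coefficients along \<open>x\<close> turn the group problem into
  \<open>at_most_two_residues\<close>. If \<open>V0\<close> is not maximal there, a larger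
  \<open>W\<close> satisfies \<open>sum b W < card G \<le> 2 * card V0 \<le> 2 * card W - 2\<close>,
  hence the second alternative of \<open>ones\<close>.\<close>

lemma at_most_two_values_if_light:
  assumes fin: "finite I" and aI: "a ` I \<subseteq> G" and cardI: "card I = card G"
    and zs: "\<And>J. J \<subseteq> I \<Longrightarrow> J \<noteq> {} \<Longrightarrow> sum a J = 0 \<Longrightarrow> card J = r"
    and nz: "\<And>i. i \<in> I \<Longrightarrow> a i \<noteq> 0"
    and V0: "V0 \<subseteq> I" "zero_sum_free a V0" and x: "x \<in> G" "light a x b0 V0"
    and long: "card G \<le> card V0 + r" "card G \<le> 2 * card V0"
    and ones: "(\<forall>i\<in>V0. b0 i = 1) \<or> (sum b0 V0 + 2 \<le> 2 * card V0 \<and>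
      (sum b0 V0 + 3 \<le> 2 * card V0 \<or> sum b0 V0 \<le> 2 * card {i \<in> V0. b0 i = 1} + 1))"
  shows "card (a ` I) \<le> 2"
proof -
  let ?n = "card G"
  have finV0: "finite V0" using V0 fin finite_subset by blast
  have "?n < 2 * (sum b0 V0 + 1)" using long(2) light_card_le[OF x(2)] by simp
  note gen = generator[OF x(1) light_nonzero[OF x(2) finV0 V0(2)] this]
  have "\<forall>i\<in>I. \<exists>c<?n. a i = nsmul c x" using gen(3) aI by blast
  then obtain b where b: "\<And>i. i \<in> I \<Longrightarrow> b i < ?n \<and> a i = nsmul (b i) x" by metis
  have unique: "c = c'" if "c < ?n" "c' < ?n" "nsmul c x = nsmul c' x" for c c'
    using that
  proof (induction c c' rule: linorder_wlog)
    case (le c c')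
    then have "nsmul (c' - c) x = 0" by (simp add: nsmul_diff)
    then have "?n dvd c' - c" using gen(2) by blast
    then show ?case using le by (metis diff_is_0_eq' dvd_imp_le le_antisym less_imp_diff_less not_gr_zero not_le zero_less_diff)
  qed simp
  have bV0: "b i = b0 i" if "i \<in> V0" for i
  proof (rule unique)
    have "b0 i \<le> sum b0 V0" using that finV0 by (simp add: member_le_sum)
    then show "b0 i < ?n" using gen(1) by simp
    show "b i < ?n" "nsmul (b i) x = nsmul (b0 i) x"
      using b[of i] that V0 x(2) by (auto simp: light_def)
  qed
  have sumV0: "sum b V0 = sum b0 V0" using bV0 by (intro sum.cong) auto
  have ab: "sum a J = nsmul (sum b J) x" if "J \<subseteq> I" for J
    using that b by (intro sum_nsmul) (auto intro: finite_subset[OF _ fin])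
  have range: "1 \<le> b i \<and> b i < ?n" if "i \<in> I" for i
    using b[OF that] nz[OF that] by (cases "b i") auto
  have zsb: "card J = r" if "J \<subseteq> I" "J \<noteq> {}" "?n dvd sum b J" for J
    using zs[OF that(1,2)] ab[OF that(1)] gen(2) that(3) by simp
  let ?Q = "\<lambda>W. W \<subseteq> I \<and> sum b W < ?n"
  have "?Q V0" using V0 sumV0 gen(1) by simp
  then have "\<exists>W. ?Q W \<and> (\<forall>W'. ?Q W' \<longrightarrow> card W' \<le> card W)"
    using card_mono[OF fin]
    by (intro ex_has_greatest_nat[of ?Q V0 card "Suc (card I)"]) (simp_all add: le_imp_less_Suc)
  then obtain W where W: "?Q W" "\<And>W'. ?Q W' \<Longrightarrow> card W' \<le> card W" by blast
  have "card (b ` I) \<le> 2"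
  proof (cases "card W = card V0")
    case True
    have "{i \<in> V0. b i = 1} = {i \<in> V0. b0 i = 1}" using bV0 by auto
    then show ?thesis
      using ones bV0 sumV0 long W True \<open>?Q V0\<close>
      by (intro at_most_two_residues[OF fin cardI range zsb, where V = V0]) auto
  next
    case False
    then have "card V0 < card W" using W(2)[OF \<open>?Q V0\<close>] by simp
    then show ?thesis
      using W long by (intro at_most_two_residues[OF fin cardI range zsb, where V = W]) auto
  qed
  moreover have "a ` I = (\<lambda>c. nsmul c x) ` b ` I"
    unfolding image_image using b by (intro image_cong) auto
  ultimately show ?thesis
    using card_image_le[of "b ` I" "\<lambda>c. nsmul c x"] fin by simp
qed

lemma at_most_two_values_if_large_order:
  assumes fin: "finite I" and aI: "a ` I \<subseteq> G" and cardI: "card I = card G"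
    and zs: "\<And>J. J \<subseteq> I \<Longrightarrow> J \<noteq> {} \<Longrightarrow> sum a J = 0 \<Longrightarrow> card J = r"
    and nz: "\<And>i. i \<in> I \<Longrightarrow> a i \<noteq> 0"
    and K: "K = {i \<in> I. a i = g}" "g \<in> G" "\<And>v. card {i \<in> I. a i = v} \<le> card K"
    and ord: "\<And>m. 0 < m \<Longrightarrow> m \<le> card K \<Longrightarrow> nsmul m g \<noteq> 0"
  shows "card (a ` I) \<le> 2"
proof -
  let ?n = "card G"
  define h where "h = card K"
  have KI: "K \<subseteq> I" using K by blast
  have finK: "finite K" using KI fin finite_subset by blast
  obtain T where T: "T \<subseteq> I" "T \<noteq> {}" "card T \<le> h" "sum a T = 0"
    using short_zero_sum[OF fin aI _ K(3)] cardI unfolding h_def by auto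
  have r: "card T = r" using zs T by blast
  have "r \<ge> 1" using r T fin finite_subset card_gt_0_iff[of T] by (metis One_nat_def Suc_leI)
  have "r \<le> h" using r T by simp
  \<comment> \<open>Two disjoint zero sums would combine to one of length
    \<open>2 * r\<close>.\<close>
  have zsf_compl: "zero_sum_free a (I - T')" if "T' \<subseteq> I" "T' \<noteq> {}" "sum a T' = 0" for T'
    unfolding zero_sum_free_def
  proof (intro allI impI notI)
    fix A assume A: "A \<subseteq> I - T'" "A \<noteq> {}" "sum a A = 0"
    have f: "finite A" "finite T'" "A \<inter> T' = {}" using A that fin finite_subset[of _ I] by blast+
    have "sum a (A \<union> T') = 0" using f A that by (simp add: sum.union_disjoint)
    then have "card (A \<union> T') = r" using A that by (intro zs) auto
    moreover have "card A = r" "card T' = r" using A that by (auto intro: zs)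
    ultimately show False using f \<open>r \<ge> 1\<close> by (simp add: card_Un_disjoint)
  qed
  have sumK: "sum a C = nsmul (card C) g" if "C \<subseteq> K" for C
    using that finK K(1) by (intro sum_const_nsmul) (auto intro: finite_subset)
  have zsfK: "zero_sum_free a K"
    unfolding zero_sum_free_def
  proof (intro allI impI)
    fix A assume A: "A \<subseteq> K" "A \<noteq> {}"
    then have "0 < card A" "card A \<le> card K"
      using finK by (auto simp: card_gt_0_iff intro: card_mono finite_subset)
    then show "sum a A \<noteq> 0" using ord sumK[OF A(1)] by simp
  qed
  have lightK: "light a g (\<lambda>_. 1) K" by (rule light_constant[OF finK]) (simp add: K(1))
  have conclude: "card (a ` I) \<le> 2"
    if "V \<subseteq> I" "zero_sum_free a V" "x \<in> G" "light a x b V"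
      "card G \<le> card V + r" "card G \<le> 2 * card V"
      "(\<forall>i\<in>V. b i = 1) \<or> (sum b V + 2 \<le> 2 * card V \<and>
        (sum b V + 3 \<le> 2 * card V \<or> sum b V \<le> 2 * card {i \<in> V. b i = 1} + 1))" for V x b
    by (rule at_most_two_values_if_light[OF fin aI cardI zs nz that])
  show ?thesis
  proof (cases "?n \<le> h + r")
    case True
    show ?thesis
      by (rule conclude[OF KI zsfK K(2) lightK]) (use True \<open>r \<le> h\<close> in \<open>auto simp: h_def\<close>)
  next
    case False
    show ?thesis
    proof (cases "?n + 2 \<le> 2 * (?n - r)")
      case True
      let ?U = "I - T"
      have U: "finite ?U" "a ` ?U \<subseteq> G" "zero_sum_free a ?U" "card ?U = ?n - r"
        using fin aI zsf_compl[of T] T r cardI finite_subset[OF T(1) fin] by (auto simp: card_Diff_subset)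
      have "?n + 2 \<le> 2 * card ?U" using True U by simp
      then obtain x b where x: "x \<in> G" "light a x b ?U"
        by (rule light_if_long[OF U(1-3)])
      have "?n < 2 * (sum b ?U + 1)" using True U light_card_le[OF x(2)] by simp
      then have "sum b ?U < ?n"
        using generator(1)[OF x(1) light_nonzero[OF x(2) U(1,3)]] by blast
      then show ?thesis
        by (intro conclude[OF _ U(3) x]) (use True U in auto)
    next
      case not_long: False
      have rh: "r = h" "?n = 2 * h + 1"
        using False not_long \<open>r \<le> h\<close> by auto
      show ?thesis
      proof (cases "zero_sum_free a (I - K)")
        case True
        let ?W = "I - K"
        have W: "finite ?W" "a ` ?W \<subseteq> G" "card ?W = h + 1"
          using fin aI KI cardI rh by (auto simp: card_Diff_subset finK h_def)
        \<comment> \<open>A subsum \<open>A\<close> with this value makes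
          \<open>A \<union> K\<close> a zero sum of length \<open>r = h = card K\<close>, so
          \<open>A\<close> is empty and \<open>nsmul h g = 0\<close>.\<close>
        have "- nsmul h g \<notin> subsums a ?W"
        proof
          assume "- nsmul h g \<in> subsums a ?W"
          then obtain A where A: "A \<subseteq> ?W" "sum a A = - nsmul h g" by (metis subsumsE)
          have f: "finite A" "A \<inter> K = {}" using A fin finite_subset[of _ I] by blast+
          have "sum a (A \<union> K) = 0"
            using f finK A sumK[of K] by (simp add: sum.union_disjoint h_def)
          moreover have "K \<noteq> {}" using \<open>r \<ge> 1\<close> rh by (auto simp: h_def)
          ultimately have "card (A \<union> K) = r" using A KI by (intro zs) auto
          then have "card A = 0" using f finK rh by (simp add: card_Un_disjoint h_def)
          then have "nsmul h g = 0" using A f by simp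
          then show False using ord[of h] \<open>r \<ge> 1\<close> rh by (simp add: h_def)
        qed
        then have "subsums a ?W \<noteq> G" using nsmul_closed[OF K(2)] uminus_closed by blast
        moreover have "?n \<le> 2 * card ?W" using W rh by simp
        ultimately obtain x b where x: "x \<in> G" "light a x b ?W"
          using light_if_not_all_subsums[OF W(1,2) True] by blast
        have "?n < 2 * (sum b ?W + 1)" using W rh light_card_le[OF x(2)] by simp
        note gen = generator[OF x(1) light_nonzero[OF x(2) W(1) True] this]
        \<comment> \<open>With total \<open>?n - 1\<close> all multiples of \<open>x\<close>, hence
          all of \<open>G\<close>, would be subsums. The unit gained here is what gives
          \<open>sum b ?W + 3 \<le> 2 * card ?W\<close>.\<close>
        have "sum b ?W + 1 \<noteq> ?n"
        proof
          assume *: "sum b ?W + 1 = ?n"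
          have "G \<subseteq> subsums a ?W"
          proof
            fix y assume "y \<in> G"
            then obtain i where "i < ?n" "y = nsmul i x" using gen(3) by blast
            then show "y \<in> subsums a ?W"
              unfolding light_subsums[OF x(2) W(1)] using * by (intro image_eqI[of _ _ i]) auto
          qed
          then show False using \<open>subsums a ?W \<noteq> G\<close> subsums_closed[OF W(2)] by blast
        qed
        then have "sum b ?W + 3 \<le> 2 * card ?W" using gen(1) W rh by simp
        then show ?thesis
          by (intro conclude[OF _ True x]) (use W rh in auto)
      next
        case not_free: False
        then obtain T' where T': "T' \<subseteq> I - K" "T' \<noteq> {}" "sum a T' = 0"
          by (auto simp: zero_sum_free_def)
        \<comment> \<open>\<open>?U\<close> consists of \<open>K\<close> and one term with
          coefficient \<open>c \<le> h\<close>. Its sum may equal \<open>2 * card ?U - 2\<close>, so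
          the alternative bounding the sum by the number of ones is used.\<close>
        let ?U = "I - T'"
        have T'I: "T' \<subseteq> I" using T' by blast
        have "card T' = r" using T' by (intro zs) auto
        then have cardU: "card ?U = h + 1"
          using T'I fin cardI rh by (simp add: card_Diff_subset finite_subset)
        have zsfU: "zero_sum_free a ?U" by (rule zsf_compl[OF T'I T'(2,3)])
        have "K \<subseteq> ?U" using T' KI by blast
        then have "card (?U - K) = 1" using cardU finK by (simp add: card_Diff_subset h_def)
        then obtain i where "?U - K = {i}" by (rule card_1_singletonE)
        then have U: "?U = insert i K" "i \<notin> K" using \<open>K \<subseteq> ?U\<close> by auto
        have "i \<in> I" using U by blast
        have "?n < 2 * (h + 1)" using rh by simp
        have gen: "nsmul m g = 0 \<longleftrightarrow> ?n dvd m" "y \<in> G \<Longrightarrow> \<exists>m<?n. y = nsmul m g" for m y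
          using generator(2,3)[OF K(2) ord[folded h_def] \<open>?n < 2 * (h + 1)\<close>] by blast+
        obtain c where c: "c < ?n" "a i = nsmul c g" using gen(2)[of "a i"] aI \<open>i \<in> I\<close> by blast
        have "c \<le> h"
        proof (rule ccontr)
          assume "\<not> c \<le> h"
          have "nsmul (?n - c) g = - nsmul c g"
            using nsmul_minus[of ?n g c] gen(1)[of ?n] c by simp
          moreover have "nsmul (?n - c) g \<in> subsums a K"
            unfolding light_subsums[OF lightK finK] using \<open>\<not> c \<le> h\<close> rh
            by (intro imageI) (simp add: h_def)
          ultimately show False
            using uminus_notin_subsums[OF finK U(2), of a] zsfU U(1) c by simp
        qed
        moreover have "c \<noteq> 0" using nz[OF \<open>i \<in> I\<close>] c by (metis nsmul.simps(1))
        ultimately have lightU: "light a g ((\<lambda>_. 1)(i := c)) ?U"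
          unfolding U(1) using c by (intro light_insert[OF lightK finK U(2)]) (auto simp: h_def)
        have sumU: "sum ((\<lambda>_. 1)(i := c)) ?U = c + h"
        proof -
          have "sum ((\<lambda>_. 1)(i := c)) K = (\<Sum>j\<in>K. 1)" using U(2) by (intro sum.cong) auto
          then show ?thesis unfolding U(1) using finK U(2) by (simp add: h_def)
        qed
        have "h \<le> card {j \<in> ?U. ((\<lambda>_. 1)(i := c)) j = 1}"
          unfolding h_def U(1) using finK U(2) by (intro card_mono) auto
        then show ?thesis
          using sumU cardU rh \<open>c \<le> h\<close>
          by (intro conclude[OF _ zsfU K(2) lightU]) auto
      qed
    qed
  qed
qed

end

text \<open>The group \<open>\<rat>/\<int>\<close> contains a copy of every finite cyclic group, so one type serves all moduli.\<close>

quotient_type circ = rat / "\<lambda>x y. x - y \<in> \<int>"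
proof (rule equivpI)
  show "reflp (\<lambda>x y :: rat. x - y \<in> \<int>)" by (simp add: reflp_def)
  show "symp (\<lambda>x y :: rat. x - y \<in> \<int>)"
    by (rule sympI) (metis Ints_minus minus_diff_eq)
  show "transp (\<lambda>x y :: rat. x - y \<in> \<int>)"
    by (rule transpI) (metis Ints_add diff_add_cancel add_diff_eq)
qed

instantiation circ :: ab_group_add
begin

lift_definition zero_circ :: circ is 0 .

lift_definition plus_circ :: "circ \<Rightarrow> circ \<Rightarrow> circ" is "(+)"
  by (metis Ints_add add_diff_add)

lift_definition uminus_circ :: "circ \<Rightarrow> circ" is uminus
  by (metis Ints_minus minus_diff_minus)

lift_definition minus_circ :: "circ \<Rightarrow> circ \<Rightarrow> circ" is "(-)"
  by (metis Ints_diff diff_diff_eq2 add_diff_eq diff_add_eq diff_diff_eq)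

instance
  by standard (transfer; simp add: algebra_simps)+

end

lift_definition residue :: "nat \<Rightarrow> int \<Rightarrow> circ" is "\<lambda>n k. of_int k / of_nat n" .

section \<open>Residues modulo \<open>n\<close> as elements of \<open>circ\<close>\<close>

lemma residue_add: "residue n (k + l) = residue n k + residue n l"
  by transfer (simp add: add_divide_distrib)

lemma residue_0 [simp]: "residue n 0 = 0"
  by transfer simp

lemma residue_uminus: "residue n (- k) = - residue n k"
  by (metis add.right_inverse add_eq_0_iff residue_0 residue_add)

lemma residue_sum: "residue n (sum a A) = (\<Sum>i\<in>A. residue n (a i))"
  by (induction A rule: infinite_finite_induct) (simp_all add: residue_add)

lemma residue_nsmul: "residue n (int m * k) = nsmul m (residue n k)"
  by (induction m) (simp_all add: residue_add algebra_simps)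

lemma residue_eq_0_iff:
  assumes "n > 0"
  shows "residue n k = 0 \<longleftrightarrow> int n dvd k"
  using assms
proof transfer
  fix n :: nat and k :: int assume n: "n > 0"
  show "(of_int k / of_nat n - 0 :: rat) \<in> \<int> \<longleftrightarrow> int n dvd k"
  proof
    assume "(of_int k / of_nat n - 0 :: rat) \<in> \<int>"
    then obtain l where "(of_int k / of_nat n :: rat) = of_int l" by (auto elim: Ints_cases)
    then have "(of_int k :: rat) = of_int (int n * l)" using n by (simp add: field_simps)
    then show "int n dvd k" by (metis dvd_triv_left of_int_eq_iff)
  qed (use n in \<open>auto simp: dvd_def\<close>)
qed

lemma residue_eq_iff:
  assumes "n > 0"
  shows "residue n k = residue n l \<longleftrightarrow> int n dvd k - l"
  using residue_eq_0_iff[OF assms, of "k - l"] residue_add[of n k "- l"] by (simp add: residue_uminus)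

lemma inj_on_residue:
  assumes "n > 0"
  shows "inj_on (residue n) {0..<int n}"
proof (rule inj_onI)
  fix k l assume kl: "k \<in> {0..<int n}" "l \<in> {0..<int n}" "residue n k = residue n l"
  then have "k mod int n = l mod int n" using residue_eq_iff[OF assms] by (metis mod_eq_dvd_iff)
  then show "k = l" using kl(1,2) by simp
qed

lemma range_residue:
  assumes "n > 0"
  shows "range (residue n) = residue n ` {0..<int n}" "card (range (residue n)) = n"
proof -
  have "residue n k \<in> residue n ` {0..<int n}" for k
  proof (rule image_eqI[of _ _ "k mod int n"])
    have "int n dvd k - k mod int n" by (simp add: minus_mod_eq_mult_div)
    then show "residue n k = residue n (k mod int n)" using residue_eq_iff[OF assms] by blast
  qed (use assms in simp)
  then show "range (residue n) = residue n ` {0..<int n}" by blast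
  then show "card (range (residue n)) = n" using inj_on_residue[OF assms] by (simp add: card_image)
qed

lemma finite_add_subgroup_residue:
  assumes "n > 0"
  shows "finite_add_subgroup (range (residue n))"
proof
  show "finite (range (residue n))" using range_residue(1)[OF assms] by simp
  show "0 \<in> range (residue n)" by (metis rangeI residue_0)
  show "x + y \<in> range (residue n)" if "x \<in> range (residue n)" "y \<in> range (residue n)" for x y
    using that by (auto simp flip: residue_add)
  show "- x \<in> range (residue n)" if "x \<in> range (residue n)" for x
    using that by (auto simp flip: residue_uminus)
qed

text \<open>Modulo the subgroup generated by \<open>g\<close>, that is, modulo \<open>d = gcd g n\<close>: a set of other terms with sum
  divisible by \<open>d\<close> can be completed by copies of \<open>g\<close> to a zero sum, which determines its sum from its
  cardinality.\<close>

lemma at_most_two_values_if_small_order: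
  fixes a :: "'i \<Rightarrow> int"
  assumes fin: "finite I" and cardI: "card I = n"
    and range: "\<And>i. i \<in> I \<Longrightarrow> 0 < a i \<and> a i < int n"
    and zs: "\<And>J. J \<subseteq> I \<Longrightarrow> J \<noteq> {} \<Longrightarrow> int n dvd sum a J \<Longrightarrow> card J = r"
    and K: "K = {i \<in> I. a i = g}" and m: "0 < m" "m \<le> card K" "int n dvd int m * g"
  shows "card (a ` I) \<le> 2"
proof -
  have KI: "K \<subseteq> I" and finK: "finite K" using K fin by auto
  have "K \<noteq> {}" using m by auto
  then have g: "0 < g" "g < int n" using K range by auto
  then have "n > 0" by simp
  define d where "d = nat (gcd g (int n))"
  have d: "int d = gcd g (int n)" "d > 0" using \<open>n > 0\<close> by (auto simp: d_def)
  then have "d dvd n" by (metis gcd_dvd2 int_dvd_int_iff)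
  then obtain q where n: "n = d * q" by (elim dvdE)
  have "q > 0" using n \<open>n > 0\<close> by simp
  obtain g' where g': "g = int d * g'" using d(1) by (metis dvdE gcd_dvd1)
  obtain u w where uw: "u * g + w * int n = int d" using bezout_int[of g "int n"] d(1) by auto
  have nqg: "int n dvd int q * g" by (simp add: n g')
  have "int q dvd int m"
  proof -
    have "int n dvd int m * int d"
    proof -
      have "int m * int d = u * (int m * g) + int m * w * int n"
        by (simp flip: uw add: algebra_simps)
      then show ?thesis using m(3) by (metis dvd_add dvd_mult dvd_triv_right)
    qed
    then show ?thesis using n d(2) by simp
  qed
  then have "q \<le> card K" using m by (meson dvd_imp_le int_dvd_int_iff le_trans)
  have sumK: "sum a C = int (card C) * g" if "C \<subseteq> K" for C
  proof -
    have "sum a C = (\<Sum>i\<in>C. g)" using that K by (intro sum.cong) auto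
    then show ?thesis by simp
  qed
  have ext: "card A + k = r"
    if A: "A \<subseteq> I - K" "k \<le> card K" "A \<noteq> {} \<or> k \<noteq> 0" "int n dvd sum a A + int k * g" for A k
  proof -
    obtain C where C: "C \<subseteq> K" "card C = k" using obtain_subset_with_card_n[OF A(2)] by blast
    have f: "finite A" "finite C" "A \<inter> C = {}"
      using A C finK fin finite_subset[of A I] finite_subset[of C K] by auto
    have "sum a (A \<union> C) = sum a A + int k * g"
      using f C sumK[OF C(1)] by (simp add: sum.union_disjoint)
    moreover have "A \<union> C \<noteq> {}" using A(3) C by auto
    ultimately have "card (A \<union> C) = r" using A C KI by (intro zs) auto
    then show ?thesis using f C by (simp add: card_Un_disjoint)
  qed
  have r: "r = q" using ext[of "{}" q] \<open>q \<le> card K\<close> \<open>q > 0\<close> nqg by simp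
  have multiple: "card A \<le> q \<and> int n dvd sum a A - int (card A) * g"
    if A: "A \<subseteq> I - K" "int d dvd sum a A" for A
  proof (cases "A = {}")
    case False
    obtain e where e: "sum a A = int d * e" using A(2) by (elim dvdE)
    \<comment> \<open>By Bezout, \<open>int d * e\<close> is congruent to \<open>e * u * g\<close>
      modulo \<open>n\<close>, so \<open>k\<close> copies of \<open>g\<close> cancel
      \<open>sum a A\<close>.\<close>
    define k where "k = nat ((- e * u) mod int q)"
    have k: "int k = (- e * u) mod int q" "k < q" using \<open>q > 0\<close> by (auto simp: k_def nat_less_iff)
    have "int q dvd int k + e * u"
      unfolding k(1) by (metis diff_minus_eq_add dvd_minus_mod minus_diff_eq minus_mult_left dvd_minus_iff)
    then have "int n dvd (int k + e * u) * g" by (metis dvd_trans mult.commute mult_dvd_mono dvd_refl n nqg g' dvd_mult2 mult.assoc of_nat_mult dvd_triv_left)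
    moreover have "sum a A + int k * g = (int k + e * u) * g + int n * (e * w)"
      unfolding e by (simp flip: uw add: algebra_simps)
    ultimately have "int n dvd sum a A + int k * g" by simp
    moreover from this have "card A + k = r"
      using False A k \<open>q \<le> card K\<close> by (intro ext) auto
    then have ck: "int (card A) = int q - int k" using r by simp
    have "sum a A - int (card A) * g = (sum a A + int k * g) - int q * g"
      by (simp add: ck algebra_simps)
    ultimately show ?thesis using nqg \<open>card A + k = r\<close> r by (metis dvd_diff le_add1)
  qed simp
  \<comment> \<open>With that many copies of \<open>g\<close>, completing \<open>A\<close> by
    \<open>2 * q - card A\<close> of them gives a zero sum of length \<open>2 * q\<close> instead of
    \<open>q\<close>.\<close>
  have less: "card K + card A < 2 * q" if A: "A \<subseteq> I - K" "int d dvd sum a A" for A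
  proof (rule ccontr)
    assume "\<not> card K + card A < 2 * q"
    note mA = multiple[OF A]
    have "int n dvd (sum a A - int (card A) * g) + 2 * (int q * g)"
      using mA nqg by (intro dvd_add) auto
    moreover have "(sum a A - int (card A) * g) + 2 * (int q * g) = sum a A + int (2 * q - card A) * g"
      using mA by (simp add: algebra_simps of_nat_diff)
    ultimately have "card A + (2 * q - card A) = r"
      using mA A \<open>\<not> card K + card A < 2 * q\<close> \<open>q > 0\<close> by (intro ext) auto
    then show False using r \<open>q > 0\<close> mA by simp
  qed
  let ?Q = "\<lambda>A. A \<subseteq> I - K \<and> int d dvd sum a A"
  have "\<exists>A. ?Q A \<and> (\<forall>A'. ?Q A' \<longrightarrow> card A' \<le> card A)"
    using card_mono[of "I - K"] fin
    by (intro ex_has_greatest_nat[of ?Q "{}" card "Suc (card (I - K))"]) (simp_all add: le_imp_less_Suc)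
  then obtain A where A: "?Q A" "\<And>A'. ?Q A' \<Longrightarrow> card A' \<le> card A" by blast
  let ?R = "I - K - A"
  interpret D: finite_add_subgroup "range (residue d)"
    by (rule finite_add_subgroup_residue[OF d(2)])
  have "zero_sum_free (\<lambda>i. residue d (a i)) ?R"
    unfolding zero_sum_free_def
  proof (intro allI impI notI)
    fix B assume B: "B \<subseteq> ?R" "B \<noteq> {}" "(\<Sum>i\<in>B. residue d (a i)) = 0"
    have "A \<subseteq> I" "B \<subseteq> I" "A \<inter> B = {}" using A(1) B(1) by auto
    then have f: "finite A" "finite B" "A \<inter> B = {}" using fin finite_subset by auto
    have "int d dvd sum a B"
      using B(3) residue_eq_0_iff[OF d(2)] by (simp flip: residue_sum)
    then have "card (A \<union> B) \<le> card A"
      using A(1) B f by (intro A(2)) (auto simp: sum.union_disjoint)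
    moreover have "card B > 0" using B f by (simp add: card_gt_0_iff)
    ultimately show False using f by (simp add: card_Un_disjoint)
  qed
  then have "card ?R < card (subsums (\<lambda>i. residue d (a i)) ?R)"
    using fin by (intro card_less_subsums) auto
  also have "\<dots> \<le> card (range (residue d))"
    by (intro card_mono D.subsums_closed) auto
  finally have R: "card ?R < d" using range_residue(2)[OF d(2)] by simp
  have total: "n = card K + card A + card ?R"
  proof -
    have "card (I - K) = card I - card K" using KI finK by (simp add: card_Diff_subset)
    moreover have "card K \<le> card I" using KI fin by (intro card_mono)
    moreover have "card ?R = card (I - K) - card A"
      using A(1) fin finite_subset[of A I] by (intro card_Diff_subset) auto
    moreover have "card A \<le> card (I - K)" using A(1) fin by (intro card_mono) auto
    ultimately show ?thesis using cardI by simp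
  qed
  have kA: "card K + card A < 2 * q" using less A(1) by blast
  have "q \<noteq> 1"
  proof
    assume "q = 1"
    then have "int n dvd g" using nqg by simp
    then show False using g zdvd_not_zless by blast
  qed
  then have "q \<ge> 2" using \<open>q > 0\<close> by simp
  \<comment> \<open>From \<open>d * q = n \<le> (2 * q - 1) + (d - 1)\<close> follows
    \<open>(d - 2) * (q - 1) \<le> 0\<close>.\<close>
  have "d \<le> 2"
  proof (rule ccontr)
    assume "\<not> d \<le> 2"
    then obtain d' where d': "d = d' + 3" by (metis add.commute le_Suc_ex not_less_eq_eq numeral_2_eq_2 numeral_3_eq_3)
    obtain q' where q': "q = q' + 2" using \<open>q \<ge> 2\<close> by (metis add.commute le_Suc_ex)
    show False using total kA R n by (simp add: d' q' algebra_simps)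
  qed
  then consider "d = 1" | "d = 2" using d(2) by linarith
  then show ?thesis
  proof cases
    case 1
    then have "card K = card I" using n \<open>q \<le> card K\<close> card_mono[OF fin KI] cardI by simp
    then have "K = I" using KI fin card_subset_eq by blast
    then show ?thesis using K by (intro card_image_le_2[of _ _ g g]) auto
  next
    case 2
    have odd: "odd (a i)" if i: "i \<in> I - K" for i
    proof
      assume "even (a i)"
      then have "int n dvd a i - g" using multiple[of "{i}"] i 2 by simp
      moreover have "\<bar>a i - g\<bar> < int n" using range[of i] i g by auto
      ultimately have "a i = g" by (metis dvd_imp_le_int eq_iff_diff_eq_0 not_le abs_of_nat)
      then show False using i K by blast
    qed
    have pair: "int n dvd a i + a j - 2 * g" if "i \<in> I - K" "j \<in> I - K" "i \<noteq> j" for i j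
      using multiple[of "{i, j}"] odd[of i] odd[of j] that 2 by simp
    have same: "a i = a j" if ij: "i \<in> I - K" "j \<in> I - K" for i j
    proof (rule ccontr)
      assume ne: "a i \<noteq> a j"
      then have "i \<noteq> j" by auto
      \<comment> \<open>A third term lets \<open>pair\<close> compare \<open>a i\<close> with
        \<open>a j\<close>. If \<open>i\<close> and \<open>j\<close> were alone outside
        \<open>K\<close>, then \<open>A = I - K\<close> and
        \<open>card K + card A = n = 2 * q\<close>, contrary to \<open>kA\<close>.\<close>
      have "\<exists>k\<in>I - K. k \<noteq> i \<and> k \<noteq> j"
      proof (rule ccontr)
        assume "\<not> ?thesis"
        then have W: "I - K = {i, j}" using ij by blast
        then have "card {i, j} \<le> card A"
          using odd ij 2 \<open>i \<noteq> j\<close> by (intro A(2)) auto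
        moreover have "card (I - K) = 2" using W \<open>i \<noteq> j\<close> by simp
        ultimately have "card A = 2" using A(1) fin card_mono[of "I - K" A] \<open>i \<noteq> j\<close> by auto
        then have "A = I - K"
          using A(1) fin \<open>card (I - K) = 2\<close> by (intro card_subset_eq) auto
        then have "card ?R = 0" by simp
        then show False using total kA n 2 by simp
      qed
      then obtain k where k: "k \<in> I - K" "k \<noteq> i" "k \<noteq> j" by blast
      have "int n dvd (a i + a k - 2 * g) - (a j + a k - 2 * g)"
        using k by (intro dvd_diff[OF pair[OF ij(1) k(1)] pair[OF ij(2) k(1)]]) auto
      then have "int n dvd a i - a j" by simp
      moreover have "\<bar>a i - a j\<bar> < int n" using range[of i] range[of j] ij by auto
      ultimately show False using ne by (metis dvd_imp_le_int eq_iff_diff_eq_0 not_le abs_of_nat)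
    qed
    show ?thesis
    proof (cases "I - K = {}")
      case True
      then show ?thesis using K by (intro card_image_le_2[of _ _ g g]) auto
    next
      case False
      then obtain j where "j \<in> I - K" by blast
      then show ?thesis using K same by (intro card_image_le_2[of _ _ g "a j"]) blast
    qed
  qed
qed

text \<open>A term \<open>0\<close> forces \<open>r = 1\<close>, and the other terms, being zero-sum
  free of length \<open>n - 1\<close>, are equal. Otherwise the order of the most frequent residue
  is compared with its multiplicity.\<close>

lemma at_most_two_values:
  fixes a :: "'i \<Rightarrow> int"
  assumes fin: "finite I" and cardI: "card I = n" and "n > 0"
    and range: "\<And>i. i \<in> I \<Longrightarrow> 0 \<le> a i \<and> a i < int n"
    and zs: "\<And>J. J \<subseteq> I \<Longrightarrow> J \<noteq> {} \<Longrightarrow> int n dvd sum a J \<Longrightarrow> card J = r"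
  shows "card (a ` I) \<le> 2"
proof -
  define c where "c i = residue n (a i)" for i
  interpret G: finite_add_subgroup "range (residue n)"
    by (rule finite_add_subgroup_residue[OF \<open>n > 0\<close>])
  have cG: "c ` I \<subseteq> range (residue n)" by (auto simp: c_def)
  have cardG: "card (range (residue n)) = n" by (rule range_residue(2)[OF \<open>n > 0\<close>])
  have sumc: "sum c J = 0 \<longleftrightarrow> int n dvd sum a J" for J
    using residue_eq_0_iff[OF \<open>n > 0\<close>] by (simp add: c_def flip: residue_sum)
  have zsc: "card J = r" if "J \<subseteq> I" "J \<noteq> {}" "sum c J = 0" for J
    using zs that sumc by blast
  have inj: "c i = c j \<longleftrightarrow> a i = a j" if "i \<in> I" "j \<in> I" for i j
    using inj_onD[OF inj_on_residue[OF \<open>n > 0\<close>], of "a i" "a j"] range that by (auto simp: c_def)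
  have "card (a ` I) = card (c ` I)"
  proof -
    have "c ` I = residue n ` a ` I" by (auto simp: c_def)
    moreover have "inj_on (residue n) (a ` I)"
      by (rule inj_on_subset[OF inj_on_residue[OF \<open>n > 0\<close>]]) (use range in auto)
    ultimately show ?thesis by (simp add: card_image)
  qed
  show ?thesis
  proof (cases "\<exists>i\<in>I. a i = 0")
    case True
    then obtain i where i: "i \<in> I" "a i = 0" by blast
    then have "r = 1" using zs[of "{i}"] by simp
    have zsf: "zero_sum_free c (I - {i})"
      unfolding zero_sum_free_def
    proof (intro allI impI notI)
      fix J assume J: "J \<subseteq> I - {i}" "J \<noteq> {}" "sum c J = 0"
      have f: "finite J" "i \<notin> J" using J fin finite_subset[of J I] by auto
      have "sum c (insert i J) = 0" using f J i by (simp add: c_def)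
      then have "card (insert i J) = 1" using J i \<open>r = 1\<close> by (intro zsc[unfolded \<open>r = 1\<close>]) auto
      then show False using f J by auto
    qed
    have same: "c j = c k" if "j \<in> I - {i}" "k \<in> I - {i}" for j k
    proof (rule G.constant_if_length_maximal[OF _ _ zsf _ that])
      show "c ` (I - {i}) \<subseteq> range (residue n)" using cG by blast
      show "card (range (residue n)) \<le> card (I - {i}) + 1" using i cardI cardG fin by simp
    qed (use fin in simp)
    have "card (c ` I) \<le> 2"
    proof (cases "I - {i} = {}")
      case True
      then show ?thesis by (intro card_image_le_2[of _ _ "c i" "c i"]) auto
    next
      case False
      then obtain j where "j \<in> I - {i}" by blast
      then show ?thesis using same by (intro card_image_le_2[of _ _ "c i" "c j"]) blast
    qed
    then show ?thesis using \<open>card (a ` I) = card (c ` I)\<close> by simp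
  next
    case False
    have nz: "c i \<noteq> 0" if "i \<in> I" for i
    proof
      assume "c i = 0"
      then have "int n dvd a i" using residue_eq_0_iff[OF \<open>n > 0\<close>] by (simp add: c_def)
      then show False using False range[OF that] that zdvd_not_zless[of "a i" "int n"] by force
    qed
    let ?fib = "\<lambda>v. {i \<in> I. c i = v}"
    have "\<exists>v. \<forall>v'. card (?fib v') \<le> card (?fib v)"
      using ex_has_greatest_nat[of "\<lambda>_. True" undefined "\<lambda>v. card (?fib v)" "Suc n"]
        card_mono[OF fin, of "?fib _"] cardI by (auto simp: le_imp_less_Suc)
    then obtain v where v: "\<And>v'. card (?fib v') \<le> card (?fib v)" by blast
    have "I \<noteq> {}" using cardI \<open>n > 0\<close> by auto
    then obtain i where "i \<in> I" by blast
    then have "card (?fib (c i)) > 0" using fin by (auto simp: card_gt_0_iff)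
    then have "card (?fib v) > 0" using v[of "c i"] by simp
    then obtain j where j: "j \<in> I" "c j = v" by (auto simp: card_gt_0_iff)
    show ?thesis
    proof (cases "\<exists>m>0. m \<le> card (?fib v) \<and> nsmul m v = 0")
      case True
      then obtain m where m: "0 < m" "m \<le> card (?fib v)" "nsmul m v = 0" by blast
      have fib: "?fib v = {i \<in> I. a i = a j}" using inj j by auto
      have pos: "0 < a i \<and> a i < int n" if "i \<in> I" for i
        using range[OF that] False that by (metis order_le_less)
      have "residue n (int m * a j) = 0"
        using m(3) j by (simp add: c_def residue_nsmul)
      then have "int n dvd int m * a j" using residue_eq_0_iff[OF \<open>n > 0\<close>] by simp
      then show ?thesis
        using at_most_two_values_if_small_order[OF fin cardI pos zs fib m(1,2)] by blast
    next
      case no: False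
      have "v \<in> range (residue n)" using j cG by blast
      then have "card (c ` I) \<le> 2"
        using no v cardI cardG
        by (intro G.at_most_two_values_if_large_order[OF fin cG _ zsc nz refl]) auto
      then show ?thesis using \<open>card (a ` I) = card (c ` I)\<close> by simp
    qed
  qed
qed

theorem theorem1p1:
  fixes n :: nat and S :: "int multiset"
  assumes "n > 0"
    and "size S = n"
    and "set_mset S \<subseteq> {0..int n - 1}"
    and "\<exists>r::int. \<forall>T. T \<subseteq># S \<and> T \<noteq> {#} \<and> [sum_mset T = 0] (mod int n)
           \<longrightarrow> int (size T) = r"
  shows "card (set_mset S) \<le> 2"
proof -
  obtain xs where xs: "mset xs = S" using ex_mset by blast
  obtain r :: int where r: "\<And>T. T \<subseteq># S \<Longrightarrow> T \<noteq> {#} \<Longrightarrow> [sum_mset T = 0] (mod int n) \<Longrightarrow> int (size T) = r"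
    using assms(4) by blast
  \<comment> \<open>Positions in a list index the terms, so that subsequences come from index
    sets.\<close>
  have S: "S = image_mset ((!) xs) (mset_set {..<n})"
  proof -
    have "length xs = n" using assms(2) xs by auto
    then have "xs = map ((!) xs) [0..<n]" using map_nth[of xs] by simp
    then show ?thesis using xs by (metis mset_map mset_upt atLeast0LessThan)
  qed
  have "card ((!) xs ` {..<n}) \<le> 2"
  proof (rule at_most_two_values[where r = "nat r"])
    fix i assume "i \<in> {..<n}"
    then have "xs ! i \<in> set_mset S" by (simp add: S)
    then show "0 \<le> xs ! i \<and> xs ! i < int n" using assms(3) by auto
  next
    fix J assume J: "J \<subseteq> {..<n}" "J \<noteq> {}" "int n dvd sum ((!) xs) J"
    let ?T = "image_mset ((!) xs) (mset_set J)"
    have "finite J" using J finite_subset by blast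
    have "int (size ?T) = r"
    proof (rule r)
      show "?T \<subseteq># S" unfolding S using J by (intro image_mset_subseteq_mono) (simp add: \<open>finite J\<close> subset_imp_msubset_mset_set)
      show "?T \<noteq> {#}" using J \<open>finite J\<close> by (simp add: mset_set_empty_iff)
      show "[sum_mset ?T = 0] (mod int n)"
        using J(3) by (simp add: cong_0_iff sum_unfold_sum_mset)
    qed
    then show "card J = nat r" by auto
  qed (use assms(1) in auto)
  moreover have "set_mset S = (!) xs ` {..<n}" by (simp add: S)
  ultimately show ?thesis by simp
qed

end
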